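(* For every $v\in\mathbb{B}_3$, $$a(Rv)=\frac{a(v)+b_1(v)+b_2(v)+b_3(v)}{4},\qquad b_1(Rv)^2=\frac{(a(v)+b_3(v))(b_1(v)+b_2(v))}{4},$$ $$b_2(Rv)^2=\frac{(a(v)+b_2(v))(b_1(v)+b_3(v))}{4},\qquad b_3(Rv)^2=\frac{(a(v)+b_1(v))(b_2(v)+b_3(v))}{4}.$$
   Context: Let $U=\begin{pmatrix}0&1&0&0\\1&0&0&0\\0&0&1&0\\0&0&0&1\end{pmatrix}$, $\mathcal{B}=\{v\in\mathbb{C}^4: v^*Uv<0\}$ (column vectors, $v^*={}^t\bar v$), $\mathbb{B}_3=\mathcal{B}/\mathbb{C}^\times$. For $v\in\mathcal{B}$ one has ${}^tvUv\neq0$ and $\tau(v)=iU\bigl(I_4-\frac{2}{{}^tvUv}\,v\,{}^tv\,U\bigr)$ lies in the Siegel upper half-space $\mathfrak{S}_4$ and depends only on the class of $v$ in $\mathbb{B}_3$. For $a,b\in\mathbb{Z}^4$, $\tau\in\mathfrak{S}_4$: $\vartheta_{a,b}(\tau)=\sum_{k\in\mathbb{Z}^4}\exp\Bigl(2\pi i\bigl(\frac12(k+\frac a2)\tau\,{}^t(k+\frac a2)+(k+\frac a2)\,{}^t(\frac b2)\bigr)\Bigr)$ (entries of $a,b$ written without commas). Let $N=\begin{pmatrix}N_{11}&N_{12}\\N_{21}&N_{22}\end{pmatrix}$ with $N_{11}=N_{22}=\mathrm{diag}(1,0,1,1)$, $N_{21}=-N_{12}=\mathrm{diag}(0,1,0,0)$,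 and $\tau(v)^\sharp=N\cdot\tau(v)=(N_{11}\tau(v)+N_{12})(N_{21}\tau(v)+N_{22})^{-1}$. Functions on $\mathbb{B}_3$: $a(v)=\vartheta_{0000,0000}(\tau(v)^\sharp)^2+\vartheta_{1100,0000}(\tau(v)^\sharp)^2$, $b_1(v)=\vartheta_{0000,0000}(\tau(v)^\sharp)^2-\vartheta_{1100,0000}(\tau(v)^\sharp)^2$, $b_2(v)=\vartheta_{0000,1100}(\tau(v)^\sharp)^2+\vartheta_{1111,1111}(\tau(v)^\sharp)^2$, $b_3(v)=\vartheta_{0000,1100}(\tau(v)^\sharp)^2-\vartheta_{1111,1111}(\tau(v)^\sharp)^2$. The mean generating transformation is $R=\frac{1}{1-i}\begin{pmatrix}1&0&0&0\\0&2&0&0\\0&0&1&-i\\0&0&-i&1\end{pmatrix}$, which satisfies $RUR^*=U$ and acts on $\mathbb{B}_3$ by $v\mapsto Rv$. *)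

theory Defs
  imports "HOL-Analysis.Analysis"
begin

text \<open>
  Both row and column vectors of length 4 are elements of \<^typ>\<open>complex^4\<close>.  The product
  \<open>bil v w\<close> is the bilinear expression ${}^t v w$; it is \<^emph>\<open>not\<close> the real inner product
  of the Euclidean space \<^typ>\<open>complex^4\<close>.
\<close>

definition bil :: "complex^4 \<Rightarrow> complex^4 \<Rightarrow> complex" where
  "bil v w = (\<Sum>i\<in>UNIV. v $ i * w $ i)"

definition cnj_vec :: "complex^4 \<Rightarrow> complex^4" where
  "cnj_vec v = (\<chi> i. cnj (v $ i))"

definition outer :: "complex^4 \<Rightarrow> complex^4 \<Rightarrow> complex^4^4" where
  "outer v w = (\<chi> i j. v $ i * w $ j)"

definition smult_mat :: "complex \<Rightarrow> complex^4^4 \<Rightarrow> complex^4^4" where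
  "smult_mat c A = (\<chi> i j. c * A $ i $ j)"

definition diag4 :: "complex^4 \<Rightarrow> complex^4^4" where
  "diag4 d = (\<chi> i j. if i = j then d $ i else 0)"


definition U :: "complex^4^4" where
  "U = vector [vector [0, 1, 0, 0],
               vector [1, 0, 0, 0],
               vector [0, 0, 1, 0],
               vector [0, 0, 0, 1]]"

definition herm_form :: "complex^4 \<Rightarrow> complex" where
  "herm_form v = bil (cnj_vec v) (U *v v)"

definition calB :: "(complex^4) set" where
  "calB = {v. herm_form v \<in> \<real> \<and> Re (herm_form v) < 0}"

definition tau_vec :: "complex^4 \<Rightarrow> complex^4^4" where
  "tau_vec v = smult_mat \<i> (U ** (mat 1 - smult_mat (2 / bil v (U *v v)) (outer v v ** U)))"

definition mean_mat :: "complex^4^4" where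
  "mean_mat = smult_mat (1 / (1 - \<i>))
     (vector [vector [1, 0, 0, 0],
              vector [0, 2, 0, 0],
              vector [0, 0, 1, - \<i>],
              vector [0, 0, - \<i>, 1]])"


lemma vec4_nth [simp]:
  "(vector [x1, x2, x3, x4] :: ('a::zero)^4) $ 1 = x1"
  "(vector [x1, x2, x3, x4] :: ('a::zero)^4) $ 2 = x2"
  "(vector [x1, x2, x3, x4] :: ('a::zero)^4) $ 3 = x3"
  "(vector [x1, x2, x3, x4] :: ('a::zero)^4) $ 4 = x4"
  by (simp_all add: vector_def)

lemma herm_form_expand:
  "herm_form v = cnj (v $ 1) * v $ 2 + cnj (v $ 2) * v $ 1 + cnj (v $ 3) * v $ 3 + cnj (v $ 4) * v $ 4"
  by (simp add: herm_form_def bil_def cnj_vec_def matrix_vector_mult_def U_def sum_4)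

lemma herm_form_real: "herm_form v \<in> \<real>"
  by (simp add: herm_form_expand complex_is_Real_iff)

lemma herm_form_scale: "herm_form (c *s v) = complex_of_real ((cmod c)\<^sup>2) * herm_form v"
  by (simp only: complex_norm_square) (simp add: herm_form_expand algebra_simps)

lemma calB_scale:
  assumes "v \<in> calB" "c \<noteq> 0"
  shows "c *s v \<in> calB"
  using assms by (simp add: calB_def herm_form_real herm_form_scale mult_pos_neg)

lemma tau_vec_scale:
  assumes "c \<noteq> 0"
  shows "tau_vec (c *s v) = tau_vec v"
proof -
  have "bil (c *s v) (U *v (c *s v)) = c * c * bil v (U *v v)"
    by (simp add: bil_def matrix_vector_mult_def sum_distrib_left mult_ac)
  moreover have "outer (c *s v) (c *s v) = smult_mat (c * c) (outer v v)"
    by (simp add: outer_def smult_mat_def vec_eq_iff mult_ac)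
  moreover have "smult_mat (x / (c * c * y)) (smult_mat (c * c) A ** B) = smult_mat (x / y) (A ** B)"
    for x y A B
    using assms
    by (simp add: smult_mat_def matrix_matrix_mult_def vec_eq_iff sum_distrib_left field_simps)
  ultimately show ?thesis by (simp add: tau_vec_def)
qed

lemma mean_mat_vec:
  "mean_mat *v v = (1 / (1 - \<i>)) *s
     vector [v $ 1, 2 * v $ 2, v $ 3 - \<i> * v $ 4, - \<i> * v $ 3 + v $ 4]"
  by (simp add: mean_mat_def smult_mat_def matrix_vector_mult_def vec_eq_iff forall_4 sum_4
      diff_divide_distrib add_divide_distrib)

lemma herm_form_mean_mat: "herm_form (mean_mat *v v) = herm_form v"
proof -
  have norm: "(cmod (1 / (1 - \<i>)))\<^sup>2 = 1 / 2"
    by (simp add: norm_divide power_divide cmod_power2)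
  show ?thesis
    unfolding mean_mat_vec herm_form_scale norm
    by (simp add: herm_form_expand algebra_simps)
qed


text \<open>The ball $\mathbb{B}_3 = \mathcal{B} / \mathbb{C}^\times$ as a type.\<close>

definition proj_eq :: "complex^4 \<Rightarrow> complex^4 \<Rightarrow> bool" where
  "proj_eq v w \<longleftrightarrow> v \<in> calB \<and> w \<in> calB \<and> (\<exists>c. c \<noteq> 0 \<and> w = c *s v)"

quotient_type ball3 = "complex^4" / partial: proj_eq
proof (rule part_equivpI)
  have "vector [1, - 1, 0, 0] \<in> calB"
    by (simp add: calB_def herm_form_real herm_form_expand)
  then show "\<exists>v. proj_eq v v"
    unfolding proj_eq_def by (metis vector_smult_lid zero_neq_one)
  show "symp proj_eq"
  proof (rule sympI)
    fix v w
    assume "proj_eq v w"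
    then obtain c where c: "v \<in> calB" "w \<in> calB" "c \<noteq> 0" "w = c *s v"
      by (auto simp: proj_eq_def)
    then have "v = inverse c *s w"
      by (simp add: vector_smult_assoc)
    with c show "proj_eq w v"
      unfolding proj_eq_def using nonzero_imp_inverse_nonzero by blast
  qed
  show "transp proj_eq"
  proof (rule transpI)
    fix u v w
    assume "proj_eq u v" "proj_eq v w"
    then show "proj_eq u w"
      unfolding proj_eq_def by (metis mult_eq_0_iff vector_smult_assoc)
  qed
qed

lift_definition tau :: "ball3 \<Rightarrow> complex^4^4" is tau_vec
  by (auto simp: proj_eq_def tau_vec_scale)

lift_definition mean_gen :: "ball3 \<Rightarrow> ball3" is "\<lambda>v. mean_mat *v v"
  by (auto simp: proj_eq_def calB_def herm_form_real herm_form_mean_mat vector_scalar_commute)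


text \<open>
  The theta series is only meaningful for \<open>\<tau>\<close> in the Siegel upper half-space, where it
  converges absolutely; elsewhere the (total) function below has no significance.
\<close>

definition half_shift :: "int^4 \<Rightarrow> int^4 \<Rightarrow> complex^4" where
  "half_shift k a = (\<chi> i. of_int (k $ i) + of_int (a $ i) / 2)"

definition theta :: "int^4 \<Rightarrow> int^4 \<Rightarrow> complex^4^4 \<Rightarrow> complex" where
  "theta a b \<tau> = (\<Sum>\<^sub>\<infinity>k\<in>UNIV.
     exp (2 * of_real pi * \<i> *
       (1 / 2 * bil (half_shift k a v* \<tau>) (half_shift k a)
        + bil (half_shift k a) (half_shift 0 b))))"

definition N11 :: "complex^4^4" where "N11 = diag4 (vector [1, 0, 1, 1])"
definition N22 :: "complex^4^4" where "N22 = diag4 (vector [1, 0, 1, 1])"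
definition N21 :: "complex^4^4" where "N21 = diag4 (vector [0, 1, 0, 0])"
definition N12 :: "complex^4^4" where "N12 = - N21"

definition sharp :: "complex^4^4 \<Rightarrow> complex^4^4" where
  "sharp \<tau> = (N11 ** \<tau> + N12) ** matrix_inv (N21 ** \<tau> + N22)"

abbreviation c0000 :: "int^4" where "c0000 \<equiv> vector [0, 0, 0, 0]"
abbreviation c1100 :: "int^4" where "c1100 \<equiv> vector [1, 1, 0, 0]"
abbreviation c1111 :: "int^4" where "c1111 \<equiv> vector [1, 1, 1, 1]"

definition fa :: "ball3 \<Rightarrow> complex" where
  "fa v = (theta c0000 c0000 (sharp (tau v)))\<^sup>2 + (theta c1100 c0000 (sharp (tau v)))\<^sup>2"

definition fb1 :: "ball3 \<Rightarrow> complex" where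
  "fb1 v = (theta c0000 c0000 (sharp (tau v)))\<^sup>2 - (theta c1100 c0000 (sharp (tau v)))\<^sup>2"

definition fb2 :: "ball3 \<Rightarrow> complex" where
  "fb2 v = (theta c0000 c1100 (sharp (tau v)))\<^sup>2 + (theta c1111 c1111 (sharp (tau v)))\<^sup>2"

definition fb3 :: "ball3 \<Rightarrow> complex" where
  "fb3 v = (theta c0000 c1100 (sharp (tau v)))\<^sup>2 - (theta c1111 c1111 (sharp (tau v)))\<^sup>2"

end

theory Submission
  imports Defs "HOL-Probability.Probability"
begin

text \<open>
  Normalise a point of the ball to \<open>v = (1, w, z, y)\<close>.  In terms of the Gaussian number \<open>\<xi> = x\<^sub>1 + \<i> x\<^sub>2\<close>,
  the quadratic form of \<open>\<tau>(v)\<^sup>\<sharp>\<close> at \<open>(x\<^sub>1, x\<^sub>2, x\<^sub>3, x\<^sub>4)\<close> couples \<open>x\<^sub>3\<close> only to \<open>\<xi> z\<close> and \<open>x\<^sub>4\<close> only to \<open>\<xi> y\<close>.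
  Summing over \<open>x\<^sub>3\<close> and \<open>x\<^sub>4\<close> first turns the four theta constants into planar lattice sums of
  \<open>exp (\<pi> w \<bar>\<xi>\<bar>\<^sup>2) \<theta>(\<xi> z) \<theta>(\<xi> y)\<close>, where \<open>\<theta>\<close> is a Jacobi theta function at \<open>\<i>\<close>, with Gaussian
  normalisation.  By Poisson summation, the even function \<open>\<theta>\<^sub>3\<close> satisfies \<open>\<theta>\<^sub>3(\<i> c) = \<theta>\<^sub>3(c)\<close>, and the odd
  function \<open>\<theta>\<^sub>1\<close> satisfies \<open>\<theta>\<^sub>1(\<i> c) = \<i> \<theta>\<^sub>1(c)\<close>.

  Substituting \<open>(\<xi>, \<xi>') = (a + b, a - b)\<close> in a product of two planar sums, the quartic relation
  of Riemann turns the terms at \<open>(w, z, y)\<close> into terms at \<open>(2w, z + y, z - y)\<close>, up to a \<open>\<theta>\<^sub>1\<close>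
  correction.  The rotation \<open>a \<mapsto> \<i> a\<close> changes the sign of \<open>\<theta>\<^sub>1\<close> terms, and on \<open>(1 + \<i>)/2 + \<int>[\<i>]\<close> also that
  of the character \<open>exp (\<pi> \<i> (x\<^sub>1 + x\<^sub>2))\<close>, so every sum in which exactly one of the two signs occurs
  vanishes.  The mean generating transformation is this duplication up to rotations \<open>y \<mapsto> \<i> y\<close>.
\<close>

subsection \<open>Poisson summation for Gaussians\<close>

text \<open>By the product-to-sum formula, one more factor \<open>cos (2 * pi * t)\<close> averages
  the integrals at the two neighbouring frequencies. Orthogonality to all cosines thus passes to all
  polynomials in \<open>cos (2 * pi * t)\<close>.\<close>

lemma cos_coefficients_mult_cos:
  fixes d :: "real \<Rightarrow> real" and n :: nat
  assumes "\<And>n::nat. ((\<lambda>t. d t * cos (2 * pi * n * t)) has_integral 0) {0..1}"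
  shows "((\<lambda>t. d t * cos (2 * pi * t) ^ k * cos (2 * pi * n * t)) has_integral 0) {0..1}"
proof (induction k arbitrary: n)
  case 0
  then show ?case using assms[of n] by simp
next
  case (Suc k)
  \<comment> \<open>At \<open>n = 0\<close> the lower neighbour is the frequency -1, which the
    evenness of the cosine replaces by 1.\<close>
  have "((\<lambda>t. (d t * cos (2 * pi * t) ^ k * cos (2 * pi * Suc n * t)
      + d t * cos (2 * pi * t) ^ k * cos (2 * pi * (if n = 0 then 1 else n - 1 :: nat) * t)) / 2)
      has_integral (0 + 0) / 2) {0..1}"
    by (intro has_integral_divide has_integral_add Suc)
  moreover have "(d t * cos (2 * pi * t) ^ k * cos (2 * pi * Suc n * t)
      + d t * cos (2 * pi * t) ^ k * cos (2 * pi * (if n = 0 then 1 else n - 1 :: nat) * t)) / 2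
     = d t * cos (2 * pi * t) ^ Suc k * cos (2 * pi * n * t)" for t
  proof -
    have "cos (2 * pi * (if n = 0 then 1 else n - 1 :: nat) * t) = cos (2 * pi * n * t - 2 * pi * t)"
      by (auto simp: algebra_simps of_nat_diff)
    moreover have "cos (2 * pi * Suc n * t) = cos (2 * pi * n * t + 2 * pi * t)"
      by (simp add: algebra_simps)
    ultimately show ?thesis
      by (simp add: cos_add cos_diff algebra_simps)
  qed
  ultimately show ?case by simp
qed

text \<open>
  The even part of \<open>d\<close> is a continuous function \<open>q\<close> of \<open>cos (2 \<pi> t)\<close>; approximating \<open>q\<close> by polynomials
  shows that the even part is orthogonal to itself.
\<close>

lemma periodic_eq_0_if_cos_coefficients_eq_0:
  fixes d :: "real \<Rightarrow> real"
  assumes cont: "continuous_on UNIV d" and per: "\<And>t. d (t + 1) = d t"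
    and cos: "\<And>n::nat. ((\<lambda>t. d t * cos (2 * pi * n * t)) has_integral 0) {0..1}"
  shows "d 0 = 0"
proof -
  \<comment> \<open>Modulo the period, reflection in 1/2 is reflection in 0, so \<open>e\<close> is
    twice the even part of \<open>d\<close>.\<close>
  define e where "e t = d t + d (1 - t)" for t
  have e_cont: "continuous_on S e" for S
    unfolding e_def by (intro continuous_intros continuous_on_compose2[OF cont]) auto
  have e_sym: "e (1 - t) = e t" for t
    by (simp add: e_def)
  define q where "q y = e (arccos y / (2 * pi))" for y
  have "continuous_on {-1..1} q"
    unfolding q_def by (intro continuous_on_compose2[OF e_cont[of UNIV]] continuous_intros) auto
  \<comment> \<open>\<open>arccos\<close> recovers \<open>t\<close> only on the first half of the
    period; the symmetry \<open>e_sym\<close> covers the second half.\<close>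
  have q: "q (cos (2 * pi * t)) = e t" if t: "t \<in> {0..1}" for t
  proof (cases "t \<le> 1 / 2")
    case True
    then have "arccos (cos (2 * pi * t)) = 2 * pi * t"
      using t by (intro arccos_cos) (auto simp: field_simps)
    then show ?thesis by (simp add: q_def)
  next
    case False
    have "cos (2 * pi * t) = cos (2 * pi * (1 - t))"
      by (simp add: algebra_simps cos_diff)
    moreover have "arccos (cos (2 * pi * (1 - t))) = 2 * pi * (1 - t)"
      using t False by (intro arccos_cos) (auto simp: field_simps)
    ultimately show ?thesis by (simp add: q_def e_sym)
  qed
  have e_cos: "((\<lambda>t. e t * cos (2 * pi * t) ^ k) has_integral 0) {0..1}" for k
  proof -
    have 1: "((\<lambda>t. d t * cos (2 * pi * t) ^ k) has_integral 0) {0..1}"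
      using cos_coefficients_mult_cos[of d k 0, OF cos] by simp
    have "((\<lambda>t. d (- t) * cos (2 * pi * (- t)) ^ k) has_integral 0) {-1..-0}"
      using 1 has_integral_reflect_real[of "\<lambda>t. d t * cos (2 * pi * t) ^ k" 0 1 0] by simp
    from has_integral_shift_real_ivl[OF this, of "-1"]
    have "((\<lambda>t. d (1 - t) * cos (2 * pi * (1 - t)) ^ k) has_integral 0) {0..1}"
      by simp
    moreover have "cos (2 * pi * (1 - t)) = cos (2 * pi * t)" for t
      by (simp add: algebra_simps cos_diff)
    ultimately have "((\<lambda>t. d t * cos (2 * pi * t) ^ k + d (1 - t) * cos (2 * pi * t) ^ k)
        has_integral 0 + 0) {0..1}"
      by (intro has_integral_add 1) simp
    then show ?thesis by (simp add: e_def algebra_simps)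
  qed
  obtain C where C: "\<bar>e t\<bar> \<le> C" if "t \<in> {0..1}" for t
    using compact_imp_bounded[OF compact_continuous_image[OF e_cont[of "{0..1}"] compact_Icc]]
    unfolding bounded_iff by (metis imageI real_norm_def)
  have e2: "(\<lambda>t. (e t)\<^sup>2) integrable_on {0..1}"
    by (intro integrable_continuous_real continuous_intros e_cont)
  define I where "I = integral {0..1} (\<lambda>t. (e t)\<^sup>2)"
  \<comment> \<open>Since \<open>e\<close> is orthogonal to \<open>g (cos (2 * pi * t))\<close>,
    \<open>I\<close> is the integral of \<open>e\<close> times the approximation error of
    \<open>q\<close> by \<open>g\<close>.\<close>
  have *: "I \<le> C * r" if "r > 0" for r
  proof -
    obtain g where g: "real_polynomial_function g" "\<And>y. y \<in> {-1..1} \<Longrightarrow> \<bar>q y - g y\<bar> < r"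
      using Stone_Weierstrass_real_polynomial_function[of "{-1..1}" q r]
        \<open>continuous_on {-1..1} q\<close> \<open>r > 0\<close> by auto
    then obtain a and n :: nat where a: "g = (\<lambda>x. \<Sum>i\<le>n. a i * x ^ i)"
      using real_polynomial_function_imp_sum by blast
    have "((\<lambda>t. \<Sum>i\<le>n. a i * (e t * cos (2 * pi * t) ^ i)) has_integral (\<Sum>i\<le>n. a i * 0)) {0..1}"
      by (intro has_integral_sum has_integral_mult_right e_cos) auto
    then have g0: "((\<lambda>t. e t * g (cos (2 * pi * t))) has_integral 0) {0..1}"
      by (simp add: a sum_distrib_left mult_ac)
    have "((\<lambda>t. (e t)\<^sup>2 - e t * g (cos (2 * pi * t))) has_integral I - 0) {0..1}"
      unfolding I_def by (intro has_integral_diff g0 integrable_integral e2)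
    then have "I - 0 \<le> integral {0..1} (\<lambda>t::real. C * r)"
    proof (rule has_integral_le[OF _ integrable_integral])
      fix t :: real assume t: "t \<in> {0..1}"
      have "(e t)\<^sup>2 - e t * g (cos (2 * pi * t)) = e t * (q (cos (2 * pi * t)) - g (cos (2 * pi * t)))"
        unfolding q[OF t] by (simp add: power2_eq_square right_diff_distrib)
      also have "\<dots> \<le> \<bar>e t\<bar> * \<bar>q (cos (2 * pi * t)) - g (cos (2 * pi * t))\<bar>"
        by (metis abs_ge_self abs_mult)
      also have "\<dots> \<le> C * r"
        using g(2)[of "cos (2 * pi * t)"] C[OF t] by (intro mult_mono) auto
      finally show "(e t)\<^sup>2 - e t * g (cos (2 * pi * t)) \<le> C * r" .
    qed auto
    then show ?thesis by simp
  qed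
  have "C \<ge> 0" using C[of 0] by auto
  have "I \<le> 0"
  proof (rule field_le_epsilon)
    fix r :: real assume "r > 0"
    \<comment> \<open>Dividing by \<open>C + 1\<close> instead of \<open>C\<close> covers the case
      \<open>C = 0\<close>.\<close>
    then have "I \<le> C * (r / (C + 1))"
      using \<open>C \<ge> 0\<close> by (intro *) auto
    also have "\<dots> \<le> 0 + r"
      using \<open>C \<ge> 0\<close> \<open>r > 0\<close> by (simp add: field_simps)
    finally show "I \<le> 0 + r" .
  qed
  moreover have "I \<ge> 0"
    unfolding I_def by (rule integral_nonneg[OF e2]) auto
  ultimately have "I = 0" by simp
  then have int0: "((\<lambda>t. (e t)\<^sup>2) has_integral 0) (cbox 0 1)"
    using integrable_integral[OF e2] by (simp add: I_def)
  have "(e 0)\<^sup>2 = 0"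
    by (rule has_integral_0_cbox_imp_0[OF _ _ int0]) (simp_all add: continuous_on_power e_cont)
  \<comment> \<open>By periodicity, \<open>e 0 = d 0 + d 1 = 2 * d 0\<close>.\<close>
  then show ?thesis
    using per[of 0] by (simp add: e_def)
qed

section \<open>Summability and domination of Gaussian series\<close>

lemma summable_on_exp_int_square:
  fixes k :: real
  assumes "k > 0"
  shows "(\<lambda>n::int. exp (- k * (real_of_int n)\<^sup>2)) summable_on UNIV"
proof -
  let ?f = "\<lambda>n::int. exp (- k * (real_of_int n)\<^sup>2)"
  have "summable (\<lambda>n. exp (- k) ^ n)"
    using assms by (intro summable_geometric) auto
  then have geo: "(\<lambda>n::nat. exp (- k) ^ n) summable_on UNIV"
    by (intro norm_summable_imp_summable_on) auto
  have nat: "(\<lambda>n::nat. exp (- k * (real n)\<^sup>2)) summable_on UNIV"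
  proof (rule summable_on_comparison_test[OF geo])
    fix n :: nat
    have "real n \<le> (real n)\<^sup>2"
      by (metis of_nat_le_iff of_nat_power power2_nat_le_imp_le le_square power2_eq_square)
    then show "exp (- k * (real n)\<^sup>2) \<le> exp (- k) ^ n"
      using assms by (simp flip: exp_of_nat_mult)
  qed auto
  have "?f summable_on range int" "?f summable_on range (\<lambda>n. - int n)"
    using nat by (subst summable_on_reindex; simp add: inj_on_def o_def)+
  then have "?f summable_on range int \<union> range (\<lambda>n. - int n)"
    by (rule summable_on_union)
  moreover have "range int \<union> range (\<lambda>n. - int n) = UNIV"
    by (auto simp: image_iff) (metis int_cases2)
  ultimately show ?thesis by simp
qed

text \<open>Allows an unordered sum over the integers to be evaluated along a sequence of windows.
  The windows are half-open because the intervals \<open>[n, n + 1]\<close> with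
  \<open>- N \<le> n < N\<close> tile \<open>[- N, N]\<close>.\<close>

lemma filterlim_int_intervals:
  "filterlim (\<lambda>N. {- int N..<int N}) (finite_subsets_at_top UNIV) sequentially"
  unfolding filterlim_finite_subsets_at_top
proof safe
  fix X :: "int set" assume X: "finite X"
  define K where "K = nat (Max (insert 0 (abs ` X)) + 1)"
  have K: "\<bar>x\<bar> < int K" if "x \<in> X" for x
  proof -
    have "\<bar>x\<bar> \<le> Max (insert 0 (abs ` X))"
      using X that by (intro Max_ge) auto
    then show ?thesis by (simp add: K_def)
  qed
  show "\<forall>\<^sub>F N in sequentially. finite {- int N..<int N} \<and> X \<subseteq> {- int N..<int N} \<and> {- int N..<int N} \<subseteq> UNIV"
    using eventually_ge_at_top[of K]
    by eventually_elim (use K in \<open>fastforce simp: abs_less_iff\<close>)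
qed

text \<open>From \<open>(2 * Re c + n)\<^sup>2 \<ge> 0\<close> follows
  \<open>(Re c + n)\<^sup>2 \<ge> n\<^sup>2 / 2 - (Re c)\<^sup>2\<close>. The factor that depends on
  \<open>n\<close> is then free of \<open>c\<close>, as a dominating series requires.\<close>

lemma norm_exp_gauss_le:
  "cmod (exp (- of_real pi * (c + of_int n)\<^sup>2)) \<le> exp (pi * (cmod c)\<^sup>2) * exp (- (pi / 2) * (real_of_int n)\<^sup>2)"
proof -
  have "0 \<le> (2 * Re c + real_of_int n)\<^sup>2" by simp
  then have "(Im c)\<^sup>2 - (Re c + real_of_int n)\<^sup>2 \<le> (cmod c)\<^sup>2 - (real_of_int n)\<^sup>2 / 2"
    unfolding cmod_power2 by (simp add: power2_eq_square algebra_simps)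
  then have "pi * ((Im c)\<^sup>2 - (Re c + real_of_int n)\<^sup>2) \<le> pi * ((cmod c)\<^sup>2 - (real_of_int n)\<^sup>2 / 2)"
    by (intro mult_left_mono) auto
  then show ?thesis
    by (simp add: power2_eq_square algebra_simps flip: exp_add)
qed

lemma norm_exp_fourier_le:
  "cmod (exp (- of_real pi * (of_int n)\<^sup>2 + 2 * of_real pi * \<i> * of_int n * c))
     \<le> exp (2 * pi * (cmod c)\<^sup>2) * exp (- (pi / 2) * (real_of_int n)\<^sup>2)"
proof -
  have "0 \<le> (2 * Im c + real_of_int n)\<^sup>2" by simp
  then have "- (real_of_int n)\<^sup>2 - 2 * real_of_int n * Im c \<le> 2 * (Im c)\<^sup>2 - (real_of_int n)\<^sup>2 / 2"
    by (simp add: power2_eq_square algebra_simps)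
  also have "\<dots> \<le> 2 * (cmod c)\<^sup>2 - (real_of_int n)\<^sup>2 / 2"
    by (simp add: cmod_power2)
  finally have "- (real_of_int n)\<^sup>2 - 2 * real_of_int n * Im c \<le> 2 * (cmod c)\<^sup>2 - (real_of_int n)\<^sup>2 / 2" .
  then have "pi * (- (real_of_int n)\<^sup>2 - 2 * real_of_int n * Im c) \<le> pi * (2 * (cmod c)\<^sup>2 - (real_of_int n)\<^sup>2 / 2)"
    by (intro mult_left_mono) auto
  then show ?thesis
    by (simp add: power2_eq_square algebra_simps flip: exp_add)
qed

text \<open>This is the characteristic function of the standard normal distribution after the
  substitution \<open>x = sqrt (2 * pi) * (Re c + t)\<close>. The imaginary part of \<open>c\<close>
  is absorbed into the real frequency \<open>l\<close> and the constant \<open>k\<close>, so the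
  integration stays on the real line.\<close>

lemma has_bochner_integral_gauss_fourier:
  fixes m :: int and c :: complex
  shows "has_bochner_integral lborel
    (\<lambda>t. exp (- of_real pi * (c + of_real t)\<^sup>2 - 2 * of_real pi * \<i> * of_int m * of_real t))
    (exp (- of_real pi * (of_int m)\<^sup>2 + 2 * of_real pi * \<i> * of_int m * c))"
proof -
  define l where "l = - sqrt (2 * pi) * (Im c + m)"
  define k where "k = exp (of_real pi * (of_real (Im c))\<^sup>2 + 2 * of_real pi * \<i> * of_int m * of_real (Re c))"
  let ?g = "\<lambda>x. std_normal_density x *\<^sub>R iexp (l * x)"
  have "integrable std_normal_distribution (\<lambda>x. iexp (l * x))"
    by (intro prob_space.integrable_iexp real_distribution.axioms real_dist_normal_dist) 
      (auto simp: real_distribution_def)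
  then have "integrable lborel ?g"
    by (subst (asm) integrable_density) auto
  moreover have "integral\<^sup>L lborel ?g = of_real (exp (- l\<^sup>2 / 2))"
    using fun_cong[OF char_std_normal_distribution, of l]
    by (simp add: char_def integral_density)
  ultimately have "has_bochner_integral lborel ?g (of_real (exp (- l\<^sup>2 / 2)))"
    by (simp add: has_bochner_integral_iff)
  then have "has_bochner_integral lborel (\<lambda>t. ?g (sqrt (2 * pi) * Re c + sqrt (2 * pi) * t))
     (of_real (exp (- l\<^sup>2 / 2)) /\<^sub>R \<bar>sqrt (2 * pi)\<bar>)"
    by (subst (asm) lborel_has_bochner_integral_real_affine_iff[of "sqrt (2 * pi)" _ _ "sqrt (2 * pi) * Re c"]) auto
  then have "has_bochner_integral lborel
     (\<lambda>t. (of_real (sqrt (2 * pi)) * k) * ?g (sqrt (2 * pi) * Re c + sqrt (2 * pi) * t))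
     ((of_real (sqrt (2 * pi)) * k) * (of_real (exp (- l\<^sup>2 / 2)) /\<^sub>R \<bar>sqrt (2 * pi)\<bar>))"
    by (intro has_bochner_integral_mult_right)
  moreover have "(of_real (sqrt (2 * pi)) * k) * ?g (sqrt (2 * pi) * Re c + sqrt (2 * pi) * t) =
      exp (- of_real pi * (c + of_real t)\<^sup>2 - 2 * of_real pi * \<i> * of_int m * of_real t)" for t
  proof -
    have "(sqrt (2 * pi) * Re c + sqrt (2 * pi) * t)\<^sup>2 / 2 = pi * (Re c + t)\<^sup>2"
      by (simp add: power_mult_distrib flip: distrib_left)
    moreover have "l * (sqrt (2 * pi) * Re c + sqrt (2 * pi) * t) = - 2 * pi * (Im c + m) * (Re c + t)"
      by (simp add: l_def algebra_simps flip: power2_eq_square)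
    ultimately have "(of_real (sqrt (2 * pi)) * k) * ?g (sqrt (2 * pi) * Re c + sqrt (2 * pi) * t)
       = k * (of_real (exp (- (pi * (Re c + t)\<^sup>2))) * iexp (- 2 * pi * (Im c + m) * (Re c + t)))"
      by (simp add: std_normal_density_def scaleR_conv_of_real)
    also have "\<dots> = exp (- of_real pi * ((of_real (Re c) + \<i> * of_real (Im c)) + of_real t)\<^sup>2 - 2 * of_real pi * \<i> * of_int m * of_real t)"
      unfolding k_def exp_of_real[symmetric] exp_add[symmetric]
      by (rule arg_cong[of _ _ exp]) (simp add: power2_eq_square algebra_simps)
    finally show ?thesis by (simp flip: complex_eq)
  qed
  moreover have "(of_real (sqrt (2 * pi)) * k) * (of_real (exp (- l\<^sup>2 / 2)) /\<^sub>R \<bar>sqrt (2 * pi)\<bar>)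
     = exp (- of_real pi * (of_int m)\<^sup>2 + 2 * of_real pi * \<i> * of_int m * c)"
  proof -
    have "l\<^sup>2 / 2 = pi * (Im c + m)\<^sup>2"
      by (simp add: l_def power_mult_distrib)
    then have "(of_real (sqrt (2 * pi)) * k) * (of_real (exp (- l\<^sup>2 / 2)) /\<^sub>R \<bar>sqrt (2 * pi)\<bar>)
       = k * of_real (exp (- (pi * (Im c + m)\<^sup>2)))"
      by (simp add: scaleR_conv_of_real)
    also have "\<dots> = exp (- of_real pi * (of_int m)\<^sup>2 + 2 * of_real pi * \<i> * of_int m * (of_real (Re c) + \<i> * of_real (Im c)))"
      unfolding k_def exp_of_real[symmetric] exp_add[symmetric]
      by (rule arg_cong[of _ _ exp]) (simp add: power2_eq_square algebra_simps)
    finally show ?thesis by (simp flip: complex_eq)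
  qed
  ultimately show ?thesis by (simp only:)
qed

text \<open>On a bounded interval the bound can be made independent of \<open>t\<close>, so the
  Weierstrass test gives uniform convergence, hence continuity and termwise integration against
  \<open>e\<close>. The constant \<open>a\<close> is free because the two sides of Poisson summation
  use \<open>pi\<close> and \<open>2 * pi\<close>.\<close>

lemma
  fixes F :: "int \<Rightarrow> real \<Rightarrow> complex" and c :: complex
  assumes bound: "\<And>n t. cmod (F n t) \<le> exp (a * (cmod (c + of_real t))\<^sup>2) * exp (- (pi / 2) * (real_of_int n)\<^sup>2)"
    and cont: "\<And>n. continuous_on UNIV (F n)" and "a \<ge> 0"
  shows continuous_on_infsum_gauss: "continuous_on UNIV (\<lambda>t. \<Sum>\<^sub>\<infinity>n. F n t)"
    and has_sum_integral_infsum_gauss: "continuous_on UNIV e \<Longrightarrow>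
      ((\<lambda>n. integral {0..1} (\<lambda>t. F n t * e t)) has_sum integral {0..1} (\<lambda>t. (\<Sum>\<^sub>\<infinity>n. F n t) * e t)) UNIV"
proof -
  define M where "M K n = exp (a * (cmod c + K)\<^sup>2) * exp (- (pi / 2) * (real_of_int n)\<^sup>2)" for K n
  have M: "M K summable_on UNIV" for K
    unfolding M_def by (intro summable_on_cmult_right summable_on_exp_int_square) auto
  have norm_le: "cmod (F n t) \<le> M K n" if "t \<in> {-K..K}" for n t K
  proof -
    have "cmod (c + of_real t) \<le> cmod c + K"
      using norm_triangle_ineq[of c "of_real t"] that by auto
    then have "exp (a * (cmod (c + of_real t))\<^sup>2) \<le> exp (a * (cmod c + K)\<^sup>2)"
      using \<open>a \<ge> 0\<close> by (auto intro!: mult_left_mono power_mono)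
    then show ?thesis
      unfolding M_def by (intro order_trans[OF bound] mult_right_mono) auto
  qed
  have ul: "uniform_limit {-K..K} (\<lambda>X t. \<Sum>n\<in>X. F n t) (\<lambda>t. \<Sum>\<^sub>\<infinity>n. F n t) (finite_subsets_at_top UNIV)" for K
    by (rule Weierstrass_m_test_general[OF _ M]) (use norm_le in auto)
  have "continuous_on {-K..K} (\<lambda>t. \<Sum>\<^sub>\<infinity>n. F n t)" for K
    by (rule uniform_limit_theorem[OF _ ul])
      (auto intro!: always_eventually continuous_on_sum continuous_on_subset[OF cont])
  then have cont': "isCont (\<lambda>t. \<Sum>\<^sub>\<infinity>n. F n t) t" for t
    by (rule continuous_on_interior[of "{- (\<bar>t\<bar> + 1)..\<bar>t\<bar> + 1}"]) auto
  then show "continuous_on UNIV (\<lambda>t. \<Sum>\<^sub>\<infinity>n. F n t)"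
    by (simp add: continuous_at_imp_continuous_on)
  assume e: "continuous_on UNIV e"
  have "compact (e ` {0..1})"
    by (intro compact_continuous_image continuous_on_subset[OF e]) auto
  then obtain b where b: "cmod (e t) \<le> b" if "t \<in> {0..1}" for t
    unfolding compact_eq_bounded_closed bounded_iff by blast
  have "uniform_limit {0..1} (\<lambda>X t. \<Sum>n\<in>X. F n t * e t) (\<lambda>t. \<Sum>\<^sub>\<infinity>n. F n t * e t) (finite_subsets_at_top UNIV)"
  proof (rule Weierstrass_m_test_general)
    show "(\<lambda>n. M 1 n * b) summable_on UNIV"
      by (intro summable_on_cmult_left M)
    show "cmod (F n t * e t) \<le> M 1 n * b" if "t \<in> {0..1}" for n t
      unfolding norm_mult using that b[OF that] norm_le[of t 1 n]
      by (intro mult_mono) (auto simp: M_def)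
  qed
  then have "uniform_limit {0..1} (\<lambda>X t. \<Sum>n\<in>X. F n t * e t) (\<lambda>t. (\<Sum>\<^sub>\<infinity>n. F n t) * e t) (finite_subsets_at_top UNIV)"
    by (simp add: infsum_cmult_left')
  then obtain I J where I: "\<And>X. ((\<lambda>t. \<Sum>n\<in>X. F n t * e t) has_integral I X) {0..1}"
    and J: "((\<lambda>t. (\<Sum>\<^sub>\<infinity>n. F n t) * e t) has_integral J) {0..1}"
    and lim: "(I \<longlongrightarrow> J) (finite_subsets_at_top UNIV)"
    by (rule uniform_limit_integral)
      (auto intro!: continuous_intros continuous_on_subset[OF cont] continuous_on_subset[OF e])
  have "I X = (\<Sum>n\<in>X. integral {0..1} (\<lambda>t. F n t * e t))" if "finite X" for X
    using integral_unique[OF I[of X]] that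
    by (subst (asm) integral_sum) (auto intro!: integrable_continuous_real continuous_intros
       continuous_on_subset[OF cont] continuous_on_subset[OF e])
  with lim show "((\<lambda>n. integral {0..1} (\<lambda>t. F n t * e t)) has_sum integral {0..1} (\<lambda>t. (\<Sum>\<^sub>\<infinity>n. F n t) * e t)) UNIV"
    unfolding has_sum_def integral_unique[OF J]
    by (subst tendsto_cong[of _ I]) (auto intro!: eventually_finite_subsets_at_top_weakI)
qed

lemma has_integral_exp_int:
  fixes k :: int
  shows "((\<lambda>t. exp (2 * of_real pi * \<i> * of_int k * of_real t)) has_integral (if k = 0 then 1 else 0)) {0..1}"
proof (cases "k = 0")
  case True
  then show ?thesis using has_integral_const_real[of "1::complex" 0 1] by simp
next
  case False
  let ?a = "2 * of_real pi * \<i> * of_int k"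
  have "((\<lambda>t. exp (?a * of_real t)) has_integral exp (?a * of_real 1) / ?a - exp (?a * of_real 0) / ?a) {0..1}"
    by (rule fundamental_theorem_of_calculus)
      (use False in \<open>auto intro!: derivative_eq_intros has_vector_derivative_real_field\<close>)
  moreover have "exp ?a = 1"
    using exp_integer_2pi[of "of_int k"] by (simp add: mult_ac)
  ultimately show ?thesis using False by simp
qed

text \<open>
  Both sides are values at \<open>t = 0\<close> of 1-periodic functions of \<open>c + t\<close> with the same Fourier
  coefficients.  Allowing complex \<open>c\<close> from the start avoids analytic continuation.
\<close>

lemma gauss_poisson_summation:
  fixes c :: complex
  shows "(\<Sum>\<^sub>\<infinity>n::int. exp (- of_real pi * (c + of_int n)\<^sup>2)) =
    (\<Sum>\<^sub>\<infinity>n::int. exp (- of_real pi * (of_int n)\<^sup>2 + 2 * of_real pi * \<i> * of_int n * c))"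
proof -
  define G where "G n t = exp (- of_real pi * (c + of_real t + of_int n)\<^sup>2)" for n :: int and t :: real
  define H where "H n t = exp (- of_real pi * (of_int n)\<^sup>2 + 2 * of_real pi * \<i> * of_int n * (c + of_real t))"
    for n :: int and t :: real
  define e where "e m t = exp (- (2 * of_real pi * \<i> * of_int m * of_real t))" for m :: int and t :: real
  \<comment> \<open>The \<open>m\<close>-th Fourier coefficient shared by both sides.\<close>
  define s where "s m = exp (- of_real pi * (of_int m)\<^sup>2 + 2 * of_real pi * \<i> * of_int m * c)" for m :: int
  define D where "D t = (\<Sum>\<^sub>\<infinity>n. G n t) - (\<Sum>\<^sub>\<infinity>n. H n t)" for t
  have G: "cmod (G n t) \<le> exp (pi * (cmod (c + of_real t))\<^sup>2) * exp (- (pi / 2) * (real_of_int n)\<^sup>2)" for n t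
    unfolding G_def by (rule norm_exp_gauss_le)
  have H: "cmod (H n t) \<le> exp (2 * pi * (cmod (c + of_real t))\<^sup>2) * exp (- (pi / 2) * (real_of_int n)\<^sup>2)" for n t
    unfolding H_def by (rule norm_exp_fourier_le)
  have Gc: "continuous_on A (G n)" and Hc: "continuous_on A (H n)" and ec: "continuous_on A (e n)" for n A
    unfolding G_def H_def e_def by (intro continuous_intros)+
  have contG: "continuous_on UNIV (\<lambda>t. \<Sum>\<^sub>\<infinity>n. G n t)" and contH: "continuous_on UNIV (\<lambda>t. \<Sum>\<^sub>\<infinity>n. H n t)"
    by (rule continuous_on_infsum_gauss[OF G Gc] continuous_on_infsum_gauss[OF H Hc]; simp)+
  \<comment> \<open>Unfolding: the integrals of the translates over the unit interval add up to the
    Fourier integral of a single Gaussian over the real line.\<close>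
  have intG: "integral {0..1} (\<lambda>t. (\<Sum>\<^sub>\<infinity>n. G n t) * e m t) = s m" for m
  proof -
    define h where "h t = exp (- of_real pi * (c + of_real t)\<^sup>2 - 2 * of_real pi * \<i> * of_int m * of_real t)" for t
    have hc: "continuous_on A h" for A
      unfolding h_def by (intro continuous_intros)
    have h: "has_bochner_integral lborel h (s m)"
      unfolding h_def s_def by (rule has_bochner_integral_gauss_fourier)
    have piece: "integral {0..1} (\<lambda>t. G n t * e m t) = integral {of_int n..of_int n + 1} h" for n
    proof -
      have "G n t * e m t = h (t + of_int n)" for t
      proof -
        have "exp (2 * of_real pi * \<i> * of_int (m * n)) = 1"
          using exp_integer_2pi[of "of_int (m * n)"] by (simp add: mult_ac)
        then have "h (t + of_int n) = h (t + of_int n) * exp (2 * of_real pi * \<i> * of_int (m * n))"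
          by simp
        also have "\<dots> = G n t * e m t"
          unfolding h_def G_def e_def exp_add[symmetric]
          by (rule arg_cong[of _ _ exp]) (simp add: algebra_simps)
        finally show ?thesis by simp
      qed
      then show ?thesis
        using integral_shift_real_ivl[of "of_int n" "of_int n" "of_int n + 1" h] by simp
    qed
    have part: "(\<Sum>n\<in>{- int N..<int N}. integral {0..1} (\<lambda>t. G n t * e m t)) = integral {- real N..real N} h" for N
    proof (induction N)
      case (Suc N)
      have "{- int (Suc N)..<int (Suc N)} = insert (- int N - 1) (insert (int N) {- int N..<int N})"
        by auto
      then have "(\<Sum>n\<in>{- int (Suc N)..<int (Suc N)}. integral {0..1} (\<lambda>t. G n t * e m t)) =
        integral {- real N - 1..- real N} h + (integral {- real N..real N} h + integral {real N..real N + 1} h)"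
        by (simp add: Suc) (simp add: piece)
      also have "\<dots> = integral {- real N - 1..real N + 1} h"
        by (simp add: Henstock_Kurzweil_Integration.integral_combine integrable_continuous_real hc)
      also have "{- real N - 1..real N + 1} = {- real (Suc N)..real (Suc N)}" by auto
      finally show ?case .
    qed simp
    have "((\<lambda>N. integral {- real N..real N} h) \<longlongrightarrow> integral {0..1} (\<lambda>t. (\<Sum>\<^sub>\<infinity>n. G n t) * e m t)) sequentially"
      using filterlim_compose[OF has_sum_integral_infsum_gauss[OF G Gc _ ec, unfolded has_sum_def]
          filterlim_int_intervals, of m]
      by (simp add: part)
    moreover have "(\<lambda>N. integral {- real N..real N} h) \<longlonglongrightarrow> s m"
    proof -
      have int: "set_integrable lborel UNIV h"
        using h by (simp add: set_integrable_def has_bochner_integral_iff)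
      have U: "(\<Union>N. {- real N..real N}) = UNIV"
      proof safe
        fix x :: real
        obtain N where "\<bar>x\<bar> \<le> real N" using real_arch_simple by blast
        then have "x \<in> {- real N..real N}" by auto
        then show "x \<in> (\<Union>N. {- real N..real N})" by blast
      qed auto
      have "(\<lambda>N. LINT t:{- real N..real N}|lborel. h t) \<longlonglongrightarrow> (LINT t:(\<Union>N. {- real N..real N})|lborel. h t)"
        by (rule set_integral_cont_up) (auto simp: incseq_def U int)
      moreover have "(LINT t:{- real N..real N}|lborel. h t) = integral {- real N..real N} h" for N
        by (intro set_borel_integral_eq_integral set_integrable_subset[OF int]) auto
      moreover have "(LINT t:UNIV|lborel. h t) = s m"
        using h by (simp add: set_lebesgue_integral_def has_bochner_integral_iff)
      ultimately show ?thesis by (simp add: U)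
    qed
    ultimately show ?thesis by (rule LIMSEQ_unique)
  qed
  have intH: "integral {0..1} (\<lambda>t. (\<Sum>\<^sub>\<infinity>n. H n t) * e m t) = s m" for m
  proof -
    have piece: "integral {0..1} (\<lambda>t. H n t * e m t) = (if n = m then s m else 0)" for n
    proof -
      have "H n t * e m t = s n * exp (2 * of_real pi * \<i> * of_int (n - m) * of_real t)" for t
        unfolding H_def e_def s_def exp_add[symmetric]
        by (rule arg_cong[of _ _ exp]) (simp add: algebra_simps)
      then have "((\<lambda>t. H n t * e m t) has_integral s n * (if n - m = 0 then 1 else 0)) {0..1}"
        using has_integral_mult_right[OF has_integral_exp_int[of "n - m"], of "s n"] by simp
      then show ?thesis by (simp add: integral_unique)
    qed
    have "((\<lambda>n. if n = m then s m else 0) has_sum integral {0..1} (\<lambda>t. (\<Sum>\<^sub>\<infinity>n. H n t) * e m t)) UNIV"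
      using has_sum_integral_infsum_gauss[OF H Hc _ ec, of m] by (simp add: piece)
    moreover have "((\<lambda>n. if n = m then s m else 0) has_sum s m) UNIV"
      by (rule has_sum_finite_neutralI[of "{m}"]) auto
    ultimately show ?thesis by (rule has_sum_unique)
  qed
  have Dc: "continuous_on A D" for A
    unfolding D_def by (rule continuous_on_subset[of UNIV]) (auto intro!: continuous_intros contG contH)
  have Dint: "((\<lambda>t. D t * e m t) has_integral 0) {0..1}" for m
  proof -
    have "(\<lambda>t. (\<Sum>\<^sub>\<infinity>n. G n t) * e m t) integrable_on {0..1}" "(\<lambda>t. (\<Sum>\<^sub>\<infinity>n. H n t) * e m t) integrable_on {0..1}"
      by (auto intro!: integrable_continuous_real continuous_intros ec
        continuous_on_subset[OF contG] continuous_on_subset[OF contH])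
    from has_integral_diff[OF this[THEN integrable_integral]] show ?thesis
      by (simp add: intG intH D_def left_diff_distrib)
  qed
  \<comment> \<open>Averaging the coefficients at \<open>n\<close> and \<open>- n\<close> gives the
    cosine coefficients that the uniqueness lemma asks for.\<close>
  have Dcos: "((\<lambda>t. D t * of_real (cos (2 * pi * n * t))) has_integral 0) {0..1}" for n :: nat
  proof -
    have "((\<lambda>t. (D t * e (int n) t + D t * e (- int n) t) / 2) has_integral (0 + 0) / 2) {0..1}"
      by (intro has_integral_divide has_integral_add Dint)
    moreover have "(D t * e (int n) t + D t * e (- int n) t) / 2 = D t * of_real (cos (2 * pi * n * t))" for t
      by (simp add: e_def cos_of_real[symmetric] cos_exp_eq algebra_simps add_divide_distrib)
    ultimately show ?thesis by simp
  qed
  have Dper: "D (t + 1) = D t" for t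
  proof -
    have "(\<Sum>\<^sub>\<infinity>n. G n (t + 1)) = (\<Sum>\<^sub>\<infinity>n. G n t)"
      by (rule infsum_reindex_bij_witness[of _ "\<lambda>n. n - 1" "\<lambda>n. n + 1"]) (auto simp: G_def algebra_simps)
    moreover have "H n (t + 1) = H n t" for n
    proof -
      have "exp (2 * of_real pi * \<i> * of_int n) = 1"
        using exp_integer_2pi[of "of_int n"] by (simp add: mult_ac)
      then have "H n t = H n t * exp (2 * of_real pi * \<i> * of_int n)" by simp
      also have "\<dots> = H n (t + 1)"
        unfolding H_def exp_add[symmetric] by (rule arg_cong[of _ _ exp]) (simp add: algebra_simps)
      finally show ?thesis by simp
    qed
    ultimately show ?thesis by (simp add: D_def)
  qed
  \<comment> \<open>The uniqueness lemma concerns real functions, so real and imaginary parts are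
    treated separately.\<close>
  have "Re (D 0) = 0"
    by (rule periodic_eq_0_if_cos_coefficients_eq_0)
      (use has_integral_Re[OF Dcos] in \<open>auto intro!: continuous_intros Dc simp: Dper\<close>)
  moreover have "Im (D 0) = 0"
    by (rule periodic_eq_0_if_cos_coefficients_eq_0)
      (use has_integral_Im[OF Dcos] in \<open>auto intro!: continuous_intros Dc simp: Dper\<close>)
  ultimately have "D 0 = 0" by (simp add: complex_eq_iff)
  then show ?thesis by (simp add: D_def G_def H_def)
qed

subsection \<open>Jacobi theta functions at the point i\<close>

lemma summable_on_times_complex:
  fixes f :: "'a \<Rightarrow> complex" and g :: "'b \<Rightarrow> complex"
  assumes "f summable_on A" "g summable_on B"
  shows "(\<lambda>(x, y). f x * g y) summable_on A \<times> B"
proof -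
  have f: "(\<lambda>x. cmod (f x)) summable_on A" and g: "(\<lambda>y. cmod (g y)) summable_on B"
    using assms by (simp_all add: summable_on_iff_abs_summable_on_complex)
  have "(\<lambda>(x, y). cmod (f x) * cmod (g y)) summable_on A \<times> B"
  proof (rule summable_on_SigmaI)
    show "((\<lambda>y. case (x, y) of (x, y) \<Rightarrow> cmod (f x) * cmod (g y)) has_sum cmod (f x) * infsum (\<lambda>y. cmod (g y)) B) B" for x
      using has_sum_cmult_right[OF has_sum_infsum[OF g]] by simp
  qed (auto intro: summable_on_cmult_left f)
  then have "(\<lambda>z. cmod (case z of (x, y) \<Rightarrow> f x * g y)) summable_on A \<times> B"
    by (simp add: case_prod_unfold norm_mult)
  then show ?thesis by (rule abs_summable_summable)
qed

lemma infsum_times_complex: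
  fixes f :: "'a \<Rightarrow> complex" and g :: "'b \<Rightarrow> complex"
  assumes "f summable_on A" "g summable_on B"
  shows "infsum f A * infsum g B = (\<Sum>\<^sub>\<infinity>(x, y)\<in>A \<times> B. f x * g y)"
  using infsum_Sigma'_banach[OF summable_on_times_complex[OF assms]]
  by (simp add: infsum_cmult_left' infsum_cmult_right')

definition half_ints :: "real set" where
  "half_ints = {x. x - 1 / 2 \<in> \<int>}"

lemma half_ints_altdef: "half_ints = range (\<lambda>n. of_int n + 1 / 2)"
  unfolding half_ints_def Ints_def by (auto simp: image_iff) (metis add.commute diff_add_cancel)

lemma of_int_plus_half_in_half_ints [simp]: "of_int n + 1 / 2 \<in> half_ints"
  by (simp add: half_ints_def)

lemma half_ints_disjoint_Ints: "x \<in> half_ints \<Longrightarrow> x \<notin> \<int>"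
proof
  assume "x \<in> half_ints" "x \<in> \<int>"
  then obtain m n where "real_of_int m = of_int n + 1 / 2"
    by (auto simp: half_ints_altdef elim!: Ints_cases)
  then have "real_of_int (2 * m) = of_int (2 * n + 1)" by simp
  then show False by (simp only: of_int_eq_iff) presburger
qed

lemma infsum_Ints: "infsum f \<int> = (\<Sum>\<^sub>\<infinity>n. f (real_of_int n))"
  and summable_on_Ints: "f summable_on \<int> \<longleftrightarrow> (\<lambda>n. f (real_of_int n)) summable_on UNIV"
  unfolding Ints_def by (simp_all add: infsum_reindex summable_on_reindex inj_on_def o_def)

lemma infsum_half_ints: "infsum f half_ints = (\<Sum>\<^sub>\<infinity>n. f (real_of_int n + 1 / 2))"
  and summable_on_half_ints: "f summable_on half_ints \<longleftrightarrow> (\<lambda>n. f (real_of_int n + 1 / 2)) summable_on UNIV"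
  unfolding half_ints_altdef by (simp_all add: infsum_reindex summable_on_reindex inj_on_def o_def)

text \<open>The term of Jacobi's theta series at \<open>\<i>\<close>, multiplied by
  \<open>exp (- pi * c\<^sup>2 / 2)\<close>. With this factor the sums grow at most like
  \<open>exp (pi / 2 * (cmod c)\<^sup>2)\<close>, and the rotation of \<open>c\<close> by
  \<open>\<i>\<close> changes them only by a constant.\<close>

definition gterm :: "complex \<Rightarrow> real \<Rightarrow> complex" where
  "gterm c x = exp (of_real pi * (- (of_real x)\<^sup>2 + 2 * c * of_real x - c\<^sup>2 / 2))"

definition theta3 :: "complex \<Rightarrow> complex" where
  "theta3 c = (\<Sum>\<^sub>\<infinity>x\<in>\<int>. gterm c x)"

text \<open>At \<open>x = n + 1 / 2\<close> the twist equals \<open>\<i> * (-1)^n\<close>, so this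
  is Jacobi's odd theta function up to a constant and the Gaussian factor.\<close>

definition theta1 :: "complex \<Rightarrow> complex" where
  "theta1 c = (\<Sum>\<^sub>\<infinity>x\<in>half_ints. exp (\<i> * of_real pi * of_real x) * gterm c x)"

lemma norm_gterm: "cmod (gterm c x) = exp (pi / 2 * (cmod c)\<^sup>2) * exp (- pi * (x - Re c)\<^sup>2)"
  unfolding gterm_def norm_exp_eq_Re exp_add[symmetric]
  by (rule arg_cong[of _ _ exp]) (simp add: cmod_power2, simp add: power2_eq_square field_simps)

text \<open>The sum has period 1 in \<open>u\<close>, so \<open>u\<close> can be replaced by
  \<open>frac u\<close>. As this lies in \<open>[0, 1)\<close>, one summable sequence
  \<open>F\<close> dominates all shifts.\<close>

lemma gauss_lattice_sum_bounded:
  obtains C where "C \<ge> 0" 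
    "\<And>u. (\<lambda>n::int. exp (- pi * (real_of_int n - u)\<^sup>2)) summable_on UNIV"
    "\<And>u. (\<Sum>\<^sub>\<infinity>n::int. exp (- pi * (real_of_int n - u)\<^sup>2)) \<le> C"
proof
  define F where "F n = exp pi * exp (- (pi / 2) * (real_of_int n)\<^sup>2)" for n
  have F: "F summable_on UNIV"
    unfolding F_def by (intro summable_on_cmult_right summable_on_exp_int_square) auto
  have le: "exp (- pi * (real_of_int n - frac u)\<^sup>2) \<le> F n" for n u
  proof -
    have "exp (- pi * (real_of_int n - frac u)\<^sup>2) \<le> exp (pi * (frac u)\<^sup>2) * exp (- (pi / 2) * (real_of_int n)\<^sup>2)"
      using norm_exp_gauss_le[of "- of_real (frac u)" n]
      by (simp add: power2_eq_square algebra_simps)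
    also have "\<dots> \<le> F n"
    proof -
      have "(frac u)\<^sup>2 \<le> 1"
        by (intro power_le_one) (auto simp: less_imp_le[OF frac_lt_1])
      then show ?thesis by (simp add: F_def)
    qed
    finally show ?thesis .
  qed
  have sf: "(\<lambda>n::int. exp (- pi * (real_of_int n - frac u)\<^sup>2)) summable_on UNIV" for u
    by (rule summable_on_comparison_test[OF F]) (use le in auto)
  have u: "real_of_int n - u = real_of_int (n - \<lfloor>u\<rfloor>) - frac u" for n u
    by (simp add: frac_def)
  have bij: "bij_betw (\<lambda>n. n - \<lfloor>u\<rfloor>) UNIV UNIV" for u :: real
    by (rule bij_betw_byWitness[where f' = "\<lambda>n. n + \<lfloor>u\<rfloor>"]) auto
  show "(\<lambda>n::int. exp (- pi * (real_of_int n - u)\<^sup>2)) summable_on UNIV" for u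
    unfolding u[of _ u] using summable_on_reindex_bij_betw[OF bij[of u], of "\<lambda>n. exp (- pi * (real_of_int n - frac u)\<^sup>2)"] sf[of u]
    by simp
  show "(\<Sum>\<^sub>\<infinity>n::int. exp (- pi * (real_of_int n - u)\<^sup>2)) \<le> infsum F UNIV" for u
    unfolding u[of _ u] infsum_reindex_bij_betw[OF bij[of u], of "\<lambda>n. exp (- pi * (real_of_int n - frac u)\<^sup>2)"]
    by (rule infsum_mono[OF sf F le])
  show "infsum F UNIV \<ge> 0"
    by (rule infsum_nonneg) (simp add: F_def)
qed

lemma gterm_norm_summable:
  assumes "A \<in> {\<int>, half_ints}"
  shows "(\<lambda>x. cmod (gterm c x)) summable_on A"
proof -
  have h: "real_of_int n + 1 / 2 - r = real_of_int n - (r - 1 / 2)" for n r by simp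
  have "(\<lambda>n::int. exp (- pi * (real_of_int n - u)\<^sup>2)) summable_on UNIV" for u
    by (rule gauss_lattice_sum_bounded) blast
  then have "(\<lambda>x. exp (- pi * (x - Re c)\<^sup>2)) summable_on A"
    using assms by (auto simp: summable_on_Ints summable_on_half_ints h simp del: mult_minus_left)
  then show ?thesis
    unfolding norm_gterm by (intro summable_on_cmult_right)
qed

text \<open>Apart from the factor in \<open>cmod c\<close>, the norms form a Gaussian lattice sum
  shifted by \<open>Re c\<close>, which is bounded uniformly in the shift. The rate
  \<open>pi / 2\<close> is the one that the condition \<open>in_ball\<close> later
  outweighs.\<close>

lemma gterm_norm_sum_bounded:
  "\<exists>C\<ge>0. \<forall>A\<in>{\<int>, half_ints}. \<forall>c. (\<Sum>\<^sub>\<infinity>x\<in>A. cmod (gterm c x)) \<le> C * exp (pi / 2 * (cmod c)\<^sup>2)"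
proof -
  obtain C where C: "C \<ge> 0" "\<And>u. (\<Sum>\<^sub>\<infinity>n::int. exp (- pi * (real_of_int n - u)\<^sup>2)) \<le> C"
    by (rule gauss_lattice_sum_bounded) blast
  have h: "real_of_int n + 1 / 2 - r = real_of_int n - (r - 1 / 2)" for n r by simp
  show ?thesis
  proof (intro exI[of _ C] conjI ballI allI C(1))
    fix A c assume A: "A \<in> {\<int>, half_ints}"
    have "(\<Sum>\<^sub>\<infinity>x\<in>A. cmod (gterm c x)) = exp (pi / 2 * (cmod c)\<^sup>2) * (\<Sum>\<^sub>\<infinity>x\<in>A. exp (- pi * (x - Re c)\<^sup>2))"
      unfolding norm_gterm by (rule infsum_cmult_right')
    also have "\<dots> \<le> exp (pi / 2 * (cmod c)\<^sup>2) * C"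
      using A C(2) by (intro mult_left_mono) (auto simp: infsum_Ints infsum_half_ints h simp del: mult_minus_left)
    finally show "(\<Sum>\<^sub>\<infinity>x\<in>A. cmod (gterm c x)) \<le> C * exp (pi / 2 * (cmod c)\<^sup>2)"
      by (simp add: mult.commute)
  qed
qed

lemma gterm_summable: "A \<in> {\<int>, half_ints} \<Longrightarrow> gterm c summable_on A"
  by (rule abs_summable_summable) (rule gterm_norm_summable)

lemma gterm_summable_twisted:
  "A \<in> {\<int>, half_ints} \<Longrightarrow> (\<lambda>x. exp (\<i> * of_real pi * of_real x) * gterm c x) summable_on A"
  by (rule abs_summable_summable) (use gterm_norm_summable in \<open>simp add: norm_mult\<close>)

lemma norm_theta_bounded:
  "\<exists>C\<ge>0. \<forall>c. cmod (theta3 c) \<le> C * exp (pi / 2 * (cmod c)\<^sup>2) \<and> cmod (theta1 c) \<le> C * exp (pi / 2 * (cmod c)\<^sup>2)"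
proof -
  obtain C where C: "C \<ge> 0"
    "\<And>A c. A \<in> {\<int>, half_ints} \<Longrightarrow> (\<Sum>\<^sub>\<infinity>x\<in>A. cmod (gterm c x)) \<le> C * exp (pi / 2 * (cmod c)\<^sup>2)"
    using gterm_norm_sum_bounded by blast
  show ?thesis
  proof (intro exI[of _ C] conjI allI C(1))
    show "cmod (theta3 c) \<le> C * exp (pi / 2 * (cmod c)\<^sup>2)" for c
      unfolding theta3_def by (rule order_trans[OF norm_infsum_bound C(2)]) (auto simp: gterm_norm_summable)
    show "cmod (theta1 c) \<le> C * exp (pi / 2 * (cmod c)\<^sup>2)" for c
      unfolding theta1_def
      using norm_infsum_bound[of "\<lambda>x. exp (\<i> * of_real pi * of_real x) * gterm c x" half_ints]
        C(2)[of half_ints c] gterm_norm_summable[of half_ints c] by (simp add: norm_mult)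
  qed
qed

text \<open>Completing the square writes the series as a Gaussian sum with shift
  \<open>- (\<i> * c)\<close>. On the dual side of Poisson summation the factor \<open>\<i>\<close>
  in the exponent cancels the one in the shift.\<close>

lemma theta3_rotate: "theta3 (\<i> * c) = theta3 c"
proof -
  have "theta3 (\<i> * c) = (\<Sum>\<^sub>\<infinity>n::int. exp (- of_real pi * (\<i> * c)\<^sup>2 / 2 * (-1)) * exp (- of_real pi * (- (\<i> * c) + of_int n)\<^sup>2))"
    unfolding theta3_def infsum_Ints gterm_def exp_add[symmetric]
    by (intro infsum_cong arg_cong[of _ _ exp]) (simp add: power2_eq_square algebra_simps)
  also have "\<dots> = (\<Sum>\<^sub>\<infinity>n::int. exp (- of_real pi * (\<i> * c)\<^sup>2 / 2 * (-1)) *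
      exp (- of_real pi * (of_int n)\<^sup>2 + 2 * of_real pi * \<i> * of_int n * (- (\<i> * c))))"
    by (simp only: infsum_cmult_right' gauss_poisson_summation)
  also have "\<dots> = theta3 c"
    unfolding theta3_def infsum_Ints gterm_def exp_add[symmetric]
    by (intro infsum_cong arg_cong[of _ _ exp]) (simp add: power2_eq_square algebra_simps)
  finally show ?thesis .
qed

text \<open>Again Poisson summation after completing the square. The twist and the half-integral
  index put the additional constants \<open>- \<i> / 2\<close> and \<open>1 / 2\<close> into the
  shift, and \<open>k\<close> collects what does not depend on \<open>n\<close>.\<close>

lemma theta1_rotate: "theta1 (\<i> * c) = \<i> * theta1 c"
proof -
  define k where "k = exp (of_real pi * (- c\<^sup>2 / 2 - c - 1 / 4))"
  have "theta1 (\<i> * c) = (\<Sum>\<^sub>\<infinity>n::int. k * exp (- of_real pi * (1 / 2 - \<i> * c - \<i> / 2 + of_int n)\<^sup>2))"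
    unfolding theta1_def infsum_half_ints gterm_def k_def exp_add[symmetric]
    by (intro infsum_cong arg_cong[of _ _ exp]) (simp add: power2_eq_square field_simps)
  also have "\<dots> = (\<Sum>\<^sub>\<infinity>n::int. k * 
      exp (- of_real pi * (of_int n)\<^sup>2 + 2 * of_real pi * \<i> * of_int n * (1 / 2 - \<i> * c - \<i> / 2)))"
    by (simp only: infsum_cmult_right' gauss_poisson_summation)
  \<comment> \<open>The dual series is a Gaussian centred at \<open>n = 1 / 2\<close> before the
    contribution of \<open>c\<close>, so this index shift moves its points to
    \<open>n + 1 / 2\<close>. The twist then differs by
    \<open>exp (\<i> * pi / 2) = \<i>\<close>.\<close>
  also have "\<dots> = (\<Sum>\<^sub>\<infinity>n::int. k * 
      exp (- of_real pi * (of_int (n + 1))\<^sup>2 + 2 * of_real pi * \<i> * of_int (n + 1) * (1 / 2 - \<i> * c - \<i> / 2)))"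
    by (rule infsum_reindex_bij_witness[of _ "\<lambda>n. n + 1" "\<lambda>n. n - 1"]) auto
  also have "\<dots> = (\<Sum>\<^sub>\<infinity>n::int. exp (\<i> * of_real (pi / 2)) * (exp (\<i> * of_real pi * of_real (of_int n + 1 / 2)) * gterm c (of_int n + 1 / 2)))"
    unfolding gterm_def k_def exp_add[symmetric]
    by (intro infsum_cong arg_cong[of _ _ exp]) (simp add: power2_eq_square field_simps)
  also have "exp (\<i> * of_real (pi / 2)) = \<i>"
    by (simp only: cis_conv_exp[symmetric] cis_pi_half)
  finally show ?thesis
    unfolding theta1_def infsum_half_ints infsum_cmult_right' .
qed

section \<open>Riemann's quartic theta relation\<close>

lemma half_lattice_hadamard_cases:
  assumes "x1 \<in> A" "x2 \<in> A" "x3 \<in> A" "x4 \<in> A" and "A = \<int> \<or> A = half_ints"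
  defines "y1 \<equiv> (x1 + x2 + x3 + x4) / 2" and "y2 \<equiv> (x1 + x2 - x3 - x4) / 2"
    and "y3 \<equiv> (x1 - x2 + x3 - x4) / 2" and "y4 \<equiv> (x1 - x2 - x3 + x4) / 2"
  obtains "y1 \<in> \<int>" "y2 \<in> \<int>" "y3 \<in> \<int>" "y4 \<in> \<int>" | "y1 \<in> half_ints" "y2 \<in> half_ints" "y3 \<in> half_ints" "y4 \<in> half_ints"
proof -
  obtain h a b c d where x: "x1 = of_int a + h" "x2 = of_int b + h" "x3 = of_int c + h" "x4 = of_int d + h"
    and h: "h = 0 \<or> h = 1 / 2"
  proof (cases "A = \<int>")
    case True
    then show ?thesis using assms(1-4) that[of _ 0] by (auto elim!: Ints_cases)
  next
    case False
    then have "A = half_ints" using assms(5) by simp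
    then show ?thesis using assms(1-4) that[of _ "1 / 2"] by (auto simp: half_ints_altdef)
  qed
  have "2 * h = of_int 0 \<or> 2 * h = of_int 1"
    using h by auto
  then obtain e where e: "2 * h = of_int e" by blast
  \<comment> \<open>The four images differ by integers, so they are integral or half-integral
    together. Since \<open>y1 = (a + b + c + d) / 2 + e\<close>, the parity of
    \<open>a + b + c + d\<close> decides.\<close>
  show ?thesis
  proof (cases "even (a + b + c + d)")
    case True
    then obtain k where "a + b + c + d = 2 * k" by blast
    then have "d = 2 * k - a - b - c" by linarith
    then have d: "real_of_int d = 2 * of_int k - of_int a - of_int b - of_int c" by simp
    have "y1 = of_int (k + e)" "y2 = of_int (a + b - k)" "y3 = of_int (a + c - k)" "y4 = of_int (k - b - c)"
      using e by (simp_all add: assms x d field_simps)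
    then show ?thesis using that(1) by simp
  next
    case False
    then obtain k where "a + b + c + d = 2 * k + 1" by (meson oddE)
    then have "d = 2 * k + 1 - a - b - c" by linarith
    then have d: "real_of_int d = 2 * of_int k + 1 - of_int a - of_int b - of_int c" by simp
    have "y1 = of_int (k + e) + 1 / 2" "y2 = of_int (a + b - k - 1) + 1 / 2"
      "y3 = of_int (a + c - k - 1) + 1 / 2" "y4 = of_int (k - b - c) + 1 / 2"
      using e by (simp_all add: assms x d field_simps)
    then show ?thesis using that(2) of_int_plus_half_in_half_ints by metis
  qed
qed

lemma exp_i_pi_int: "exp (\<i> * of_real pi * of_int (2 * n)) = 1"
  using exp_integer_2pi[of "of_int n"] by (simp add: mult_ac)

text \<open>
  The vectors in \<open>\<int>\<^sup>4 \<union> (1/2 + \<int>)\<^sup>4\<close> form the weight lattice of type \<open>D\<^sub>4\<close>, which is stable under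
  half the Hadamard matrix \<open>M\<close>.  The characters of \<^const>\<open>theta1\<close> give the weight \<open>-1\<close> exactly to
  the half-integral vectors with odd coordinate sum, a class that \<open>M\<close> maps to itself.
\<close>
lemma theta_quartic:
  "theta3 (p + q) * theta3 (p - q) * theta3 (r + s) * theta3 (r - s)
     + theta1 (p + q) * theta1 (p - q) * theta1 (r + s) * theta1 (r - s)
   = theta3 (p + r) * theta3 (p - r) * theta3 (q + s) * theta3 (q - s)
     + theta1 (p + r) * theta1 (p - r) * theta1 (q + s) * theta1 (q - s)"
proof -
  define e :: "real \<Rightarrow> complex" where "e x = exp (\<i> * of_real pi * of_real x)" for x
  define K where "K a b c d = (\<lambda>((x1, x2), (x3, x4)). (gterm a x1 * gterm b x2) * (gterm c x3 * gterm d x4))"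
    for a b c d
  define wt where "wt = (\<lambda>((x1, x2), (x3, x4)). if x1 \<in> \<int> then 1 else e (x1 + x2 + x3 + x4))"
  define L3 :: "((real \<times> real) \<times> (real \<times> real)) set" where "L3 = (\<int> \<times> \<int>) \<times> (\<int> \<times> \<int>)"
  define L1 where "L1 = (half_ints \<times> half_ints) \<times> (half_ints \<times> half_ints)"
  have sum: "(\<lambda>z. wt z * K a b c d z) summable_on L3" "(\<lambda>z. wt z * K a b c d z) summable_on L1"
    "(\<Sum>\<^sub>\<infinity>z\<in>L3. wt z * K a b c d z) = theta3 a * theta3 b * theta3 c * theta3 d"
    "(\<Sum>\<^sub>\<infinity>z\<in>L1. wt z * K a b c d z) = theta1 a * theta1 b * theta1 c * theta1 d" for a b c d
  proof -
    define G3 where "G3 = (\<lambda>(z, z'). (case z of (x1, x2) \<Rightarrow> gterm a x1 * gterm b x2) * (case z' of (x3, x4) \<Rightarrow> gterm c x3 * gterm d x4))"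
    have g3: "gterm c summable_on \<int>" for c
      by (rule gterm_summable) simp
    have G3: "wt z * K a b c d z = G3 z" if "z \<in> L3" for z
      using that by (auto simp: L3_def wt_def K_def G3_def)
    have "G3 summable_on L3"
      unfolding G3_def L3_def by (intro summable_on_times_complex g3)
    then show "(\<lambda>z. wt z * K a b c d z) summable_on L3"
      using summable_on_cong[of L3 "\<lambda>z. wt z * K a b c d z" G3] G3 by simp
    have "(\<Sum>\<^sub>\<infinity>z\<in>L3. wt z * K a b c d z) = infsum G3 L3"
      by (rule infsum_cong) (rule G3)
    also have "\<dots> = theta3 a * theta3 b * theta3 c * theta3 d"
      unfolding G3_def L3_def theta3_def 
      by (simp only: infsum_times_complex[symmetric] summable_on_times_complex g3) (simp only: mult.assoc)
    finally show "(\<Sum>\<^sub>\<infinity>z\<in>L3. wt z * K a b c d z) = theta3 a * theta3 b * theta3 c * theta3 d" .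
    define G1 where "G1 = (\<lambda>(z, z'). (case z of (x1, x2) \<Rightarrow> (e x1 * gterm a x1) * (e x2 * gterm b x2)) * (case z' of (x3, x4) \<Rightarrow> (e x3 * gterm c x3) * (e x4 * gterm d x4)))"
    have g1: "(\<lambda>x. e x * gterm c x) summable_on half_ints" for c
      unfolding e_def by (rule gterm_summable_twisted) simp
    have G1: "wt z * K a b c d z = G1 z" if "z \<in> L1" for z
      using that half_ints_disjoint_Ints
      by (auto simp: L1_def wt_def K_def G1_def e_def distrib_left exp_add)
    have "G1 summable_on L1"
      unfolding G1_def L1_def by (intro summable_on_times_complex g1)
    then show "(\<lambda>z. wt z * K a b c d z) summable_on L1"
      using summable_on_cong[of L1 "\<lambda>z. wt z * K a b c d z" G1] G1 by simp
    have "(\<Sum>\<^sub>\<infinity>z\<in>L1. wt z * K a b c d z) = infsum G1 L1"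
      by (rule infsum_cong) (rule G1)
    also have "\<dots> = theta1 a * theta1 b * theta1 c * theta1 d"
      unfolding G1_def L1_def theta1_def e_def[symmetric]
      by (simp only: infsum_times_complex[symmetric] summable_on_times_complex g1) (simp only: mult.assoc)
    finally show "(\<Sum>\<^sub>\<infinity>z\<in>L1. wt z * K a b c d z) = theta1 a * theta1 b * theta1 c * theta1 d" .
  qed
  have disj: "L3 \<inter> L1 = {}"
    using half_ints_disjoint_Ints by (auto simp: L3_def L1_def)
  define M where "M = (\<lambda>((x1, x2), (x3, x4)).
    (((x1 + x2 + x3 + x4) / 2, (x1 + x2 - x3 - x4) / 2), ((x1 - x2 + x3 - x4) / 2, (x1 - x2 - x3 + x4 :: real) / 2)))"
  have MM: "M (M z) = z" for z
    by (auto simp: M_def field_simps split: prod.splits)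
  have M_mem: "M z \<in> L3 \<union> L1" if z: "z \<in> L3 \<union> L1" for z
  proof -
    obtain A x1 x2 x3 x4 where "z = ((x1, x2), (x3, x4))" "x1 \<in> A" "x2 \<in> A" "x3 \<in> A" "x4 \<in> A" "A = \<int> \<or> A = half_ints"
      using z by (auto simp: L3_def L1_def)
    then show ?thesis
      using half_lattice_hadamard_cases[of x1 A x2 x3 x4] by (auto simp: M_def L3_def L1_def)
  qed
  have e_even: "e (of_int (2 * n)) = 1" for n
    using exp_i_pi_int[of n] by (simp add: e_def)
  have wt3: "wt z = 1" if "z \<in> L3" for z
    using that by (auto simp: L3_def wt_def)
  \<comment> \<open>The coordinates of \<open>M z\<close> add up to \<open>2 * x1\<close>, here an
    even integer, so the weight is 1 whether \<open>M z\<close> is integral or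
    half-integral.\<close>
  have wtM3: "wt (M z) = 1" if z: "z \<in> L3" for z
  proof -
    obtain x1 x2 x3 x4 where z': "z = ((x1, x2), (x3, x4))" and "x1 \<in> \<int>" using z by (auto simp: L3_def)
    then obtain n where "x1 = of_int n" by (auto elim: Ints_cases)
    then have "(x1 + x2 + x3 + x4) / 2 + (x1 + x2 - x3 - x4) / 2 + (x1 - x2 + x3 - x4) / 2 + (x1 - x2 - x3 + x4) / 2
        = of_int (2 * n)"
      by (simp add: field_simps)
    then show ?thesis unfolding z' wt_def M_def prod.case by (simp only: e_even if_cancel)
  qed
  have wtM: "wt (M z) = wt z" if z: "z \<in> L3 \<union> L1" for z
  proof (cases "z \<in> L3 \<or> M z \<in> L3")
    case True
    then show ?thesis using wt3 wtM3[of z] wtM3[of "M z"] unfolding MM by metis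
  next
    case False
    then have "z \<in> L1" "M z \<in> L1" using z M_mem[OF z] by auto
    then obtain x1 x2 x3 x4 y1 y2 y3 y4 where xy: "z = ((x1, x2), (x3, x4))" "M z = ((y1, y2), (y3, y4))"
      "x1 \<in> half_ints" "y1 \<in> half_ints"
      by (auto simp: L1_def)
    from xy have sums: "y1 + y2 + y3 + y4 = 2 * x1" "x1 + x2 + x3 + x4 = 2 * y1"
      by (auto simp: M_def)
    \<comment> \<open>Both coordinate sums are twice a half-integer, hence odd, so both weights are
      -1.\<close>
    have e_half: "e (2 * x) = e 1" if "x \<in> half_ints" for x
    proof -
      from that obtain k where "x = of_int k + 1 / 2" by (auto simp: half_ints_altdef)
      then show ?thesis using e_even[of k] by (simp add: e_def distrib_left exp_add)
    qed
    have "wt (M z) = e (y1 + y2 + y3 + y4)"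
      unfolding xy(2) using xy(4) half_ints_disjoint_Ints by (simp add: wt_def)
    moreover have "wt z = e (x1 + x2 + x3 + x4)"
      unfolding xy(1) using xy(3) half_ints_disjoint_Ints by (simp add: wt_def)
    ultimately show ?thesis by (simp only: sums e_half xy)
  qed
  \<comment> \<open>\<open>M\<close> is symmetric and orthogonal, and it sends the arguments
    \<open>(p + q, p - q, r + s, r - s)\<close> to \<open>(p + r, p - r, q + s, q - s)\<close>. The
    exponent depends only on inner products of lattice vector and argument vector.\<close>
  have K: "K (p + r) (p - r) (q + s) (q - s) (M z) = K (p + q) (p - q) (r + s) (r - s) z" for z
  proof -
    obtain x1 x2 x3 x4 where z: "z = ((x1, x2), (x3, x4))" by (metis prod.exhaust)
    show ?thesis
      unfolding z K_def M_def prod.case gterm_def exp_add[symmetric]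
      by (rule arg_cong[of _ _ exp]) (simp add: power2_eq_square field_simps)
  qed
  have split: "(\<Sum>\<^sub>\<infinity>z\<in>L3 \<union> L1. wt z * K a b c d z) =
     theta3 a * theta3 b * theta3 c * theta3 d + theta1 a * theta1 b * theta1 c * theta1 d" for a b c d
    by (subst infsum_Un_disjoint[OF sum(1,2) disj]) (simp add: sum)
  have "(\<Sum>\<^sub>\<infinity>z\<in>L3 \<union> L1. wt z * K (p + q) (p - q) (r + s) (r - s) z) =
    (\<Sum>\<^sub>\<infinity>z\<in>L3 \<union> L1. wt z * K (p + r) (p - r) (q + s) (q - s) z)"
    by (rule infsum_reindex_bij_witness[of _ M M]) (simp_all only: MM M_mem wtM K)
  then show ?thesis
    by (simp add: split)
qed

subsection \<open>Sums over Gaussian integers\<close>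

definition gauss_ints :: "complex set" where
  "gauss_ints = {x. Re x \<in> \<int> \<and> Im x \<in> \<int>}"

definition half_gauss_ints :: "complex set" where
  "half_gauss_ints = {x. Re x \<in> half_ints \<and> Im x \<in> half_ints}"

text \<open>On Gaussian integers this is the nontrivial character modulo \<open>1 + \<i>\<close>. On
  \<open>half_gauss_ints\<close> it also takes only the values 1 and -1.\<close>

definition gchar :: "complex \<Rightarrow> complex" where
  "gchar x = exp (\<i> * of_real pi * of_real (Re x + Im x))"

lemma gauss_intsE:
  assumes "x \<in> gauss_ints"
  obtains m n where "x = Complex (of_int m) (of_int n)"
proof -
  from assms obtain m n where "Re x = of_int m" "Im x = of_int n"
    by (auto simp: gauss_ints_def elim!: Ints_cases)
  then show ?thesis using that[of m n] by (simp add: complex_eq_iff)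
qed

lemma half_gauss_intsE:
  assumes "x \<in> half_gauss_ints"
  obtains m n where "x = Complex (of_int m + 1 / 2) (of_int n + 1 / 2)"
proof -
  from assms obtain m n where "Re x = of_int m + 1 / 2" "Im x = of_int n + 1 / 2"
    by (auto simp: half_gauss_ints_def half_ints_altdef)
  then show ?thesis using that[of m n] by (simp add: complex_eq_iff)
qed

lemma Complex_in_gauss_ints [simp]: "Complex (of_int m) (of_int n) \<in> gauss_ints"
  by (simp add: gauss_ints_def)

lemma Complex_in_half_gauss_ints [simp]: "Complex (of_int m + 1 / 2) (of_int n + 1 / 2) \<in> half_gauss_ints"
  by (simp add: half_gauss_ints_def)

lemma gauss_ints_disjoint: "gauss_ints \<inter> half_gauss_ints = {}"
  using half_ints_disjoint_Ints by (auto simp: gauss_ints_def half_gauss_ints_def)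

lemma exp_i_pi_of_int: "exp (\<i> * of_real pi * of_int n) = (if even n then 1 else - 1)"
proof (cases "even n")
  case True
  then show ?thesis using exp_i_pi_int by auto
next
  case False
  then obtain k where "n = 2 * k + 1" by (rule oddE)
  then show ?thesis
    using exp_i_pi_int[of k] by (simp add: distrib_left exp_add mult.commute[of \<i>])
qed

lemma gchar_Complex_int: "gchar (Complex (of_int m) (of_int n)) = (if even (m + n) then 1 else - 1)"
  using exp_i_pi_of_int[of "m + n"] by (simp add: gchar_def)

lemma gchar_Complex_half: "gchar (Complex (of_int m + 1 / 2) (of_int n + 1 / 2)) = (if even (m + n) then - 1 else 1)"
proof -
  have *: "of_int m + 1 / 2 + (of_int n + 1 / 2) = (of_int (m + n + 1) :: real)" by simp
  show ?thesis
    using exp_i_pi_of_int[of "m + n + 1"] unfolding gchar_def complex.sel * of_real_of_int_eq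
    by simp
qed

lemma gchar_add: "gchar (x + y) = gchar x * gchar y"
  by (simp add: gchar_def algebra_simps flip: exp_add)

lemma gchar_square: "x \<in> gauss_ints \<union> half_gauss_ints \<Longrightarrow> gchar x * gchar x = 1"
  by (auto elim!: gauss_intsE half_gauss_intsE simp: gchar_Complex_int gchar_Complex_half)

lemma gchar_rotate_int: "x \<in> gauss_ints \<Longrightarrow> gchar (\<i> * x) = gchar x"
proof (elim gauss_intsE)
  fix m n assume x: "x = Complex (of_int m) (of_int n)"
  then have "\<i> * x = Complex (of_int (- n)) (of_int m)" by (simp add: complex_eq_iff)
  then show ?thesis unfolding x by (simp only: gchar_Complex_int) simp
qed

lemma gchar_rotate_half: "x \<in> half_gauss_ints \<Longrightarrow> gchar (\<i> * x) = - gchar x"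
proof (elim half_gauss_intsE)
  fix m n assume x: "x = Complex (of_int m + 1 / 2) (of_int n + 1 / 2)"
  then have "\<i> * x = Complex (of_int (- n - 1) + 1 / 2) (of_int m + 1 / 2)" by (simp add: complex_eq_iff)
  then show ?thesis unfolding x by (simp only: gchar_Complex_half) simp
qed

lemma gauss_ints_add [intro]: "x \<in> gauss_ints \<Longrightarrow> y \<in> gauss_ints \<Longrightarrow> x + y \<in> gauss_ints"
  and gauss_ints_diff [intro]: "x \<in> gauss_ints \<Longrightarrow> y \<in> gauss_ints \<Longrightarrow> x - y \<in> gauss_ints"
  by (auto simp: gauss_ints_def)

lemma half_gauss_ints_diff_int: "x \<in> half_gauss_ints \<Longrightarrow> y \<in> gauss_ints \<Longrightarrow> x - y \<in> half_gauss_ints"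
  and half_gauss_ints_add_int: "x \<in> half_gauss_ints \<Longrightarrow> y \<in> gauss_ints \<Longrightarrow> y + x \<in> half_gauss_ints"
  and half_gauss_ints_int_diff: "x \<in> half_gauss_ints \<Longrightarrow> y \<in> gauss_ints \<Longrightarrow> y - x \<in> half_gauss_ints"
  and half_gauss_ints_add: "x \<in> half_gauss_ints \<Longrightarrow> z \<in> half_gauss_ints \<Longrightarrow> x + z \<in> gauss_ints"
  and half_gauss_ints_diff: "x \<in> half_gauss_ints \<Longrightarrow> z \<in> half_gauss_ints \<Longrightarrow> x - z \<in> gauss_ints"
proof -
  assume x: "x \<in> half_gauss_ints"
  then obtain m n where x': "x = Complex (of_int m + 1 / 2) (of_int n + 1 / 2)" by (rule half_gauss_intsE)
  {
    assume "y \<in> gauss_ints"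
    then obtain k l where y: "y = Complex (of_int k) (of_int l)" by (rule gauss_intsE)
    have "x - y = Complex (of_int (m - k) + 1 / 2) (of_int (n - l) + 1 / 2)"
      "y + x = Complex (of_int (k + m) + 1 / 2) (of_int (l + n) + 1 / 2)"
      "y - x = Complex (of_int (k - m - 1) + 1 / 2) (of_int (l - n - 1) + 1 / 2)"
      by (simp_all add: x' y complex_eq_iff)
    then show "x - y \<in> half_gauss_ints" "y + x \<in> half_gauss_ints" "y - x \<in> half_gauss_ints"
      by (simp_all only: Complex_in_half_gauss_ints)
  }
  {
    assume "z \<in> half_gauss_ints"
    then obtain k l where z: "z = Complex (of_int k + 1 / 2) (of_int l + 1 / 2)" by (rule half_gauss_intsE)
    have "x + z = Complex (of_int (m + k + 1)) (of_int (n + l + 1))" "x - z = Complex (of_int (m - k)) (of_int (n - l))"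
      by (simp_all add: x' z complex_eq_iff)
    then show "x + z \<in> gauss_ints" "x - z \<in> gauss_ints"
      by (simp_all only: Complex_in_gauss_ints)
  }
qed

lemma half_even_gauss_int:
  assumes "x \<in> gauss_ints" "gchar x = 1"
  shows "x / 2 \<in> gauss_ints \<union> half_gauss_ints"
proof -
  obtain m n where x: "x = Complex (of_int m) (of_int n)" using assms(1) by (rule gauss_intsE)
  have "even (m + n)"
    using assms(2) by (auto simp: x gchar_Complex_int split: if_splits)
  show ?thesis
  proof (cases "even m")
    case True
    with \<open>even (m + n)\<close> have "even n" by presburger
    with True obtain k l where "m = 2 * k" "n = 2 * l" by (elim evenE)
    then have "x / 2 = Complex (of_int k) (of_int l)" by (simp add: x complex_eq_iff)
    then show ?thesis by simp
  next
    case False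
    with \<open>even (m + n)\<close> have "odd n" by presburger
    with False obtain k l where "m = 2 * k + 1" "n = 2 * l + 1" by (elim oddE)
    then have "x / 2 = Complex (of_int k + 1 / 2) (of_int l + 1 / 2)" by (simp add: x complex_eq_iff add_divide_distrib)
    then show ?thesis by simp
  qed
qed

lemma rotate_gauss_ints: "x \<in> gauss_ints \<Longrightarrow> \<i> * x \<in> gauss_ints"
  by (auto simp: gauss_ints_def)

lemma rotate_half_gauss_ints: "x \<in> half_gauss_ints \<Longrightarrow> \<i> * x \<in> half_gauss_ints"
proof (elim half_gauss_intsE)
  fix m n assume x: "x = Complex (of_int m + 1 / 2) (of_int n + 1 / 2)"
  then have "\<i> * x = Complex (of_int (- n - 1) + 1 / 2) (of_int m + 1 / 2)" by (simp add: complex_eq_iff)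
  then show ?thesis by (simp only: Complex_in_half_gauss_ints)
qed

section \<open>Vanishing and duplication of lattice sums\<close>

lemma infsum_eq_0_if_rotation_odd:
  fixes f :: "complex \<Rightarrow> complex"
  assumes A: "\<And>x. x \<in> A \<Longrightarrow> \<i> * x \<in> A" and odd: "\<And>x. x \<in> A \<Longrightarrow> f (\<i> * x) = - f x"
  shows "infsum f A = 0"
proof -
  \<comment> \<open>Three rotations give the inverse rotation, so multiplication by
    \<open>\<i>\<close> permutes \<open>A\<close> and the sum equals its own negative.\<close>
  have 3: "- (\<i> * x) \<in> A" if "x \<in> A" for x
    using A[OF A[OF A[OF that]]] by simp
  have "infsum f A = (\<Sum>\<^sub>\<infinity>x\<in>A. - f x)"
    by (rule infsum_reindex_bij_witness[of _ "\<lambda>x. \<i> * x" "\<lambda>x. - (\<i> * x)"])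
      (use odd[OF 3] in \<open>auto simp: A 3\<close>)
  then show ?thesis by (simp add: infsum_uminus)
qed

lemma infsum_eq_0_if_odd:
  fixes f :: "complex \<Rightarrow> complex"
  assumes "\<And>x. x \<in> A \<Longrightarrow> - x \<in> A" and "\<And>x. x \<in> A \<Longrightarrow> f (- x) = - f x"
  shows "infsum f A = 0"
proof -
  have "infsum f A = (\<Sum>\<^sub>\<infinity>x\<in>A. - f x)"
    by (rule infsum_reindex_bij_witness[of _ uminus uminus]) (use assms in auto)
  then show ?thesis by (simp add: infsum_uminus)
qed

lemma sum_diff_halves:
  fixes x y :: complex
  shows "(x + y + (x - y)) / 2 = x" "(x + y - (x - y)) / 2 = y" "(x + y) / 2 + (x - y) / 2 = x" "(x + y) / 2 - (x - y) / 2 = y"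
  by (simp_all add: field_simps)

text \<open>Isolates what the lattice argument needs from the theta functions. \<open>F3\<close> and
  \<open>F1\<close> stand for the summands at \<open>(2 * w, z + y, z - y)\<close>,
  \<open>H3\<close> and \<open>H1\<close> for those at \<open>(w, z, y)\<close>, built from
  \<open>theta3\<close> and \<open>theta1\<close>. The sign under rotation comes from two factors
  \<open>theta1\<close>, each contributing \<open>\<i>\<close>.\<close>

locale lattice_quartic =
  fixes F3 F1 H3 H1 :: "complex \<Rightarrow> complex"
  assumes summable: "F3 summable_on gauss_ints \<union> half_gauss_ints" "F1 summable_on gauss_ints \<union> half_gauss_ints"
     "H3 summable_on gauss_ints \<union> half_gauss_ints" "H1 summable_on gauss_ints \<union> half_gauss_ints"
  and quartic: "\<And>a b. F3 a * F3 b + F1 a * F1 b = H3 (a + b) * H3 (a - b) + H1 (a + b) * H1 (a - b)"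
  and rotate: "\<And>x. F3 (\<i> * x) = F3 x" "\<And>x. F1 (\<i> * x) = - F1 x" 
     "\<And>x. H3 (\<i> * x) = H3 x" "\<And>x. H1 (\<i> * x) = - H1 x"
begin

lemma summable':
  assumes "\<And>x. cmod (u x) = 1" "A \<subseteq> gauss_ints \<union> half_gauss_ints" "f \<in> {F3, F1, H3, H1}"
  shows "(\<lambda>x. u x * f x) summable_on A"
proof -
  have "(\<lambda>x. cmod (f x)) summable_on gauss_ints \<union> half_gauss_ints"
    using assms(3) summable by (auto simp: summable_on_iff_abs_summable_on_complex)
  then have "(\<lambda>x. cmod (u x * f x)) summable_on A"
    unfolding norm_mult assms(1) mult_1 using assms(2) by (rule summable_on_subset_banach)
  then show ?thesis by (rule abs_summable_summable)
qed

text \<open>The substitution \<open>(x, y) = (a + b, a - b)\<close> maps the pairs from equal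
  cosets, \<open>X\<close>, onto the pairs of Gaussian integers with
  \<open>gchar (x + y) = 1\<close>, \<open>Y\<close>; since \<open>\<psi>\<close> is multiplicative,
  \<open>\<psi> x\<close> splits over \<open>a\<close> and \<open>b\<close>. On Gaussian integers
  \<open>1 + gchar x * gchar y\<close> is twice the indicator of \<open>Y\<close>, whence the factor
  2.\<close>

lemma parity_duplication:
  assumes "\<psi> = (\<lambda>_. 1) \<or> \<psi> = gchar"
  defines "S \<equiv> (\<lambda>f A. infsum (\<lambda>x. \<psi> x * f x) A)"
  shows "2 * ((S F3 gauss_ints)\<^sup>2 + (S F3 half_gauss_ints)\<^sup>2 + (S F1 gauss_ints)\<^sup>2 + (S F1 half_gauss_ints)\<^sup>2)
    = S H3 gauss_ints * infsum H3 gauss_ints + infsum (\<lambda>x. gchar x * \<psi> x * H3 x) gauss_ints * infsum (\<lambda>x. gchar x * H3 x) gauss_ints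
    + S H1 gauss_ints * infsum H1 gauss_ints + infsum (\<lambda>x. gchar x * \<psi> x * H1 x) gauss_ints * infsum (\<lambda>x. gchar x * H1 x) gauss_ints"
proof -
  let ?G = gauss_ints and ?K = half_gauss_ints
  define X where "X = ?G \<times> ?G \<union> ?K \<times> ?K"
  define Y where "Y = {(x, y). x \<in> ?G \<and> y \<in> ?G \<and> gchar (x + y) = 1}"
  have gchar_norm: "cmod (gchar x) = 1" for x by (simp add: gchar_def)
  have psi_norm: "cmod (\<psi> x) = 1" for x using assms(1) gchar_norm by auto
  have psi_add: "\<psi> (x + y) = \<psi> x * \<psi> y" for x y using assms(1) gchar_add by auto
  have sF: "(\<lambda>x. \<psi> x * f x) summable_on A" if "A \<subseteq> ?G \<union> ?K" "f \<in> {F3, F1, H3, H1}" for f A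
    using summable'[of \<psi>, OF psi_norm that] .
  have sP: "(\<lambda>(x, y). (u x * f x) * (v y * g y)) summable_on A \<times> B"
    if "A \<subseteq> ?G \<union> ?K" "f \<in> {F3, F1, H3, H1}" "B \<subseteq> ?G \<union> ?K" "g \<in> {F3, F1, H3, H1}"
       "\<And>x. cmod (u x) = 1" "\<And>x. cmod (v x) = 1" for f g u v A B
    by (intro summable_on_times_complex summable' that)
  have lhs: "(\<lambda>(x, y). (\<psi> x * f x) * (\<psi> y * f y)) summable_on X"
    "(\<Sum>\<^sub>\<infinity>(x, y)\<in>X. (\<psi> x * f x) * (\<psi> y * f y)) = (S f ?G)\<^sup>2 + (S f ?K)\<^sup>2" if "f \<in> {F3, F1}" for f
  proof -
    have f: "f \<in> {F3, F1, H3, H1}" using that by auto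
    have 1: "(\<lambda>(x, y). (\<psi> x * f x) * (\<psi> y * f y)) summable_on ?G \<times> ?G"
        "(\<lambda>(x, y). (\<psi> x * f x) * (\<psi> y * f y)) summable_on ?K \<times> ?K"
      by (intro sP f psi_norm; simp)+
    have disj: "(?G \<times> ?G) \<inter> (?K \<times> ?K) = {}" using gauss_ints_disjoint by auto
    show "(\<lambda>(x, y). (\<psi> x * f x) * (\<psi> y * f y)) summable_on X"
      unfolding X_def by (intro summable_on_Un_disjoint 1 disj)
    show "(\<Sum>\<^sub>\<infinity>(x, y)\<in>X. (\<psi> x * f x) * (\<psi> y * f y)) = (S f ?G)\<^sup>2 + (S f ?K)\<^sup>2"
      unfolding X_def S_def power2_eq_square infsum_Un_disjoint[OF 1 disj]
      using infsum_times_complex[OF sF sF, of ?G f ?G f] infsum_times_complex[OF sF sF, of ?K f ?K f] f by simp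
  qed
  have rhs: "(\<lambda>(x, y). (\<psi> x * f x) * f y) summable_on Y"
    "2 * (\<Sum>\<^sub>\<infinity>(x, y)\<in>Y. (\<psi> x * f x) * f y) =
      S f ?G * infsum f ?G + infsum (\<lambda>x. gchar x * \<psi> x * f x) ?G * infsum (\<lambda>x. gchar x * f x) ?G"
    if "f \<in> {H3, H1}" for f
  proof -
    have f: "f \<in> {F3, F1, H3, H1}" using that by auto
    have 1: "(\<lambda>(x, y). (\<psi> x * f x) * (1 * f y)) summable_on ?G \<times> ?G"
      by (intro sP f psi_norm) auto
    then have 1: "(\<lambda>(x, y). (\<psi> x * f x) * f y) summable_on ?G \<times> ?G" by simp
    then show "(\<lambda>(x, y). (\<psi> x * f x) * f y) summable_on Y"
      by (rule summable_on_subset_banach) (auto simp: Y_def)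
    have 2: "(\<lambda>(x, y). (gchar x * \<psi> x * f x) * (gchar y * f y)) summable_on ?G \<times> ?G"
      by (intro sP f) (auto simp: norm_mult psi_norm gchar_norm)
    have sums: "(\<lambda>x. \<psi> x * f x) summable_on ?G" "f summable_on ?G"
        "(\<lambda>x. gchar x * \<psi> x * f x) summable_on ?G" "(\<lambda>x. gchar x * f x) summable_on ?G"
      using summable'[of "\<lambda>_. 1" ?G f] f
      by (auto intro!: summable' simp: norm_mult psi_norm gchar_norm)
    have "S f ?G * infsum f ?G + infsum (\<lambda>x. gchar x * \<psi> x * f x) ?G * infsum (\<lambda>x. gchar x * f x) ?G
      = (\<Sum>\<^sub>\<infinity>(x, y)\<in>?G \<times> ?G. (\<psi> x * f x) * f y) + (\<Sum>\<^sub>\<infinity>(x, y)\<in>?G \<times> ?G. (gchar x * \<psi> x * f x) * (gchar y * f y))"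
      unfolding S_def by (simp only: infsum_times_complex sums)
    also have "\<dots> = (\<Sum>\<^sub>\<infinity>z\<in>?G \<times> ?G. (case z of (x, y) \<Rightarrow> (\<psi> x * f x) * f y) + (case z of (x, y) \<Rightarrow> (gchar x * \<psi> x * f x) * (gchar y * f y)))"
      by (rule infsum_add[OF 1 2, symmetric])
    also have "\<dots> = (\<Sum>\<^sub>\<infinity>z\<in>Y. 2 * (case z of (x, y) \<Rightarrow> (\<psi> x * f x) * f y))"
    proof (rule infsum_cong_neutral)
      fix z assume "z \<in> ?G \<times> ?G \<inter> Y"
      then obtain x y where z: "z = (x, y)" and "gchar x * gchar y = 1" by (auto simp: Y_def gchar_add)
      have "(gchar x * \<psi> x * f x) * (gchar y * f y) = (gchar x * gchar y) * ((\<psi> x * f x) * f y)"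
        by (simp only: mult_ac)
      then show "(case z of (x, y) \<Rightarrow> (\<psi> x * f x) * f y) + (case z of (x, y) \<Rightarrow> (gchar x * \<psi> x * f x) * (gchar y * f y)) =
        2 * (case z of (x, y) \<Rightarrow> (\<psi> x * f x) * f y)"
        unfolding z prod.case \<open>gchar x * gchar y = 1\<close> by simp
    next
      fix z assume zz: "z \<in> ?G \<times> ?G - Y"
      then obtain x y where z: "z = (x, y)" and "x + y \<in> ?G" "gchar (x + y) \<noteq> 1" by (auto simp: Y_def)
      moreover from \<open>x + y \<in> ?G\<close> have "gchar (x + y) * gchar (x + y) = 1"
        by (intro gchar_square) simp
      ultimately have "gchar x * gchar y = - 1"
        by (simp only: square_eq_1_iff) (simp add: gchar_add)
      have "(gchar x * \<psi> x * f x) * (gchar y * f y) = (gchar x * gchar y) * ((\<psi> x * f x) * f y)"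
        by (simp only: mult_ac)
      then show "(case z of (x, y) \<Rightarrow> (\<psi> x * f x) * f y) + (case z of (x, y) \<Rightarrow> (gchar x * \<psi> x * f x) * (gchar y * f y)) = 0"
        unfolding z prod.case \<open>gchar x * gchar y = - 1\<close> by simp
    qed (auto simp: Y_def)
    finally show "2 * (\<Sum>\<^sub>\<infinity>(x, y)\<in>Y. (\<psi> x * f x) * f y) =
      S f ?G * infsum f ?G + infsum (\<lambda>x. gchar x * \<psi> x * f x) ?G * infsum (\<lambda>x. gchar x * f x) ?G"
      by (simp add: infsum_cmult_right')
  qed
  have XY: "(a + b, a - b) \<in> Y" if "(a, b) \<in> X" for a b
  proof -
    have "gchar (a + b + (a - b)) = gchar a * gchar a"
      unfolding gchar_add[symmetric] by simp
    also have "\<dots> = 1" using that by (intro gchar_square) (auto simp: X_def)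
    finally show ?thesis
      using that by (auto simp: X_def Y_def half_gauss_ints_add half_gauss_ints_diff)
  qed
  have YX: "((x + y) / 2, (x - y) / 2) \<in> X" if "(x, y) \<in> Y" for x y
  proof -
    have xy: "x \<in> ?G" "y \<in> ?G" "gchar (x + y) = 1" using that by (auto simp: Y_def)
    \<comment> \<open>The two halves differ by the Gaussian integer \<open>y\<close>, so they lie in
      the same coset.\<close>
    have d: "(x - y) / 2 = (x + y) / 2 - y" by (simp add: field_simps)
    have "(x + y) / 2 \<in> ?G \<union> ?K" using xy by (intro half_even_gauss_int) auto
    then show ?thesis unfolding d X_def
      using xy half_gauss_ints_diff_int by auto
  qed
  have "(\<Sum>\<^sub>\<infinity>z\<in>X. (case z of (a, b) \<Rightarrow> (\<psi> a * F3 a) * (\<psi> b * F3 b)) + (case z of (a, b) \<Rightarrow> (\<psi> a * F1 a) * (\<psi> b * F1 b)))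
    = (\<Sum>\<^sub>\<infinity>z\<in>Y. (case z of (x, y) \<Rightarrow> (\<psi> x * H3 x) * H3 y) + (case z of (x, y) \<Rightarrow> (\<psi> x * H1 x) * H1 y))"
  proof (rule infsum_reindex_bij_witness[of _ "\<lambda>(x, y). ((x + y) / 2, (x - y) / 2)" "\<lambda>(a, b). (a + b, a - b)"])
    fix z assume "z \<in> X"
    obtain a b where z: "z = (a, b)" by fastforce
    have "(\<psi> (a + b) * H3 (a + b)) * H3 (a - b) + (\<psi> (a + b) * H1 (a + b)) * H1 (a - b) = \<psi> (a + b) * (F3 a * F3 b + F1 a * F1 b)"
      unfolding quartic by (simp only: distrib_left mult_ac)
    also have "\<dots> = (\<psi> a * F3 a) * (\<psi> b * F3 b) + (\<psi> a * F1 a) * (\<psi> b * F1 b)"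
      by (simp only: psi_add distrib_left mult_ac)
    finally show "(case case z of (a, b) \<Rightarrow> (a + b, a - b) of (x, y) \<Rightarrow> (\<psi> x * H3 x) * H3 y)
       + (case case z of (a, b) \<Rightarrow> (a + b, a - b) of (x, y) \<Rightarrow> (\<psi> x * H1 x) * H1 y)
       = (case z of (a, b) \<Rightarrow> (\<psi> a * F3 a) * (\<psi> b * F3 b)) + (case z of (a, b) \<Rightarrow> (\<psi> a * F1 a) * (\<psi> b * F1 b))"
      by (simp add: z)
  qed (auto simp: XY YX sum_diff_halves)
  moreover have "(\<Sum>\<^sub>\<infinity>z\<in>X. (case z of (a, b) \<Rightarrow> (\<psi> a * F3 a) * (\<psi> b * F3 b)) + (case z of (a, b) \<Rightarrow> (\<psi> a * F1 a) * (\<psi> b * F1 b)))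
    = (S F3 ?G)\<^sup>2 + (S F3 ?K)\<^sup>2 + ((S F1 ?G)\<^sup>2 + (S F1 ?K)\<^sup>2)"
    by (subst infsum_add) (simp_all only: lhs insertI1 insertI2)
  moreover have "(\<Sum>\<^sub>\<infinity>z\<in>Y. (case z of (x, y) \<Rightarrow> (\<psi> x * H3 x) * H3 y) + (case z of (x, y) \<Rightarrow> (\<psi> x * H1 x) * H1 y))
    = (\<Sum>\<^sub>\<infinity>(x, y)\<in>Y. (\<psi> x * H3 x) * H3 y) + (\<Sum>\<^sub>\<infinity>(x, y)\<in>Y. (\<psi> x * H1 x) * H1 y)"
    by (rule infsum_add) (simp_all only: rhs insertI1 insertI2)
  ultimately show ?thesis
    using rhs(2)[of H3] rhs(2)[of H1] by (simp add: algebra_simps)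
qed

lemma gauss_sum_odd_eq_0:
  "infsum F1 gauss_ints = 0" "infsum F1 half_gauss_ints = 0" "infsum H1 gauss_ints = 0" "infsum H1 half_gauss_ints = 0"
  "infsum (\<lambda>x. gchar x * F1 x) gauss_ints = 0" "infsum (\<lambda>x. gchar x * H1 x) gauss_ints = 0"
  "infsum (\<lambda>x. gchar x * F3 x) half_gauss_ints = 0" "infsum (\<lambda>x. gchar x * H3 x) half_gauss_ints = 0"
  by (rule infsum_eq_0_if_rotation_odd;
      simp add: rotate_gauss_ints rotate_half_gauss_ints rotate gchar_rotate_int gchar_rotate_half)+

lemma even_duplication:
  "2 * ((infsum F3 gauss_ints)\<^sup>2 + (infsum F3 half_gauss_ints)\<^sup>2) =
     (infsum H3 gauss_ints)\<^sup>2 + (infsum (\<lambda>x. gchar x * H3 x) gauss_ints)\<^sup>2"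
  using parity_duplication[of "\<lambda>_. 1"] by (simp add: gauss_sum_odd_eq_0 power2_eq_square)

text \<open>For \<open>\<psi> = gchar\<close> the two products on the right of
  \<open>parity_duplication\<close> coincide, because \<open>gchar\<close> squares to 1 on Gaussian
  integers. The factor 2 then cancels.\<close>

lemma character_duplication:
  "(infsum (\<lambda>x. gchar x * F3 x) gauss_ints)\<^sup>2 + (infsum (\<lambda>x. gchar x * F1 x) half_gauss_ints)\<^sup>2 =
     infsum H3 gauss_ints * infsum (\<lambda>x. gchar x * H3 x) gauss_ints"
proof -
  have arith: "a\<^sup>2 + b\<^sup>2 = p * r" if "2 * (a\<^sup>2 + 0\<^sup>2 + 0\<^sup>2 + b\<^sup>2) = r * p + p * r + 0 * 0 + 0 * 0"
    for a b p r :: complex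
  proof -
    have "2 * (a\<^sup>2 + b\<^sup>2) = r * p + p * r" using that by simp
    also have "\<dots> = 2 * (p * r)" by (simp add: mult.commute)
    finally show ?thesis by (metis mult_cancel_left zero_neq_numeral)
  qed
  have square: "infsum (\<lambda>x. gchar x * gchar x * f x) gauss_ints = infsum f gauss_ints" for f
    by (intro infsum_cong) (simp add: gchar_square)
  show ?thesis
    using parity_duplication[OF disjI2[OF refl]] unfolding square gauss_sum_odd_eq_0 by (rule arith)
qed

text \<open>
  On pairs of half-integral points, the average of the four characters of \<open>\<int>[\<i>]/2\<int>[\<i>]\<close> detects whether
  \<open>(x + y)/2\<close> is integral.
\<close>

lemma product_duplication:
  "4 * (infsum F3 gauss_ints * infsum F3 half_gauss_ints) =
     (infsum H3 half_gauss_ints)\<^sup>2 + (infsum (\<lambda>x. gchar x * H1 x) half_gauss_ints)\<^sup>2"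
proof -
  let ?G = gauss_ints and ?K = half_gauss_ints
  define X where "X = ?G \<times> ?K"
  \<comment> \<open>The image of \<open>X\<close> under
    \<open>(a, b) \<mapsto> (a + b, a - b)\<close>: both entries are half-integral, and their mean
    is the Gaussian integer \<open>a\<close>.\<close>
  define Y where "Y = {(x, y). x \<in> ?K \<and> y \<in> ?K \<and> (x + y) / 2 \<in> ?G}"
  define e1 e2 where "e1 x = exp (\<i> * of_real pi * of_real (Re x))"
    and "e2 x = exp (\<i> * of_real pi * of_real (Im x))" for x
  have norms: "cmod (e1 x) = 1" "cmod (e2 x) = 1" "cmod (gchar x) = 1" for x
    by (simp_all add: e1_def e2_def gchar_def)
  have mults: "e1 (x + y) = e1 x * e1 y" "e2 (x + y) = e2 x * e2 y" "gchar x = e1 x * e2 x" for x y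
    by (simp_all add: e1_def e2_def gchar_def algebra_simps flip: exp_add)
  have e_int: "e1 (Complex (of_int m) (of_int n)) = (if even m then 1 else - 1)"
    "e2 (Complex (of_int m) (of_int n)) = (if even n then 1 else - 1)" for m n
    using exp_i_pi_of_int by (simp_all add: e1_def e2_def)
  have lhs: "(\<lambda>(x, y). f x * f y) summable_on X" "(\<Sum>\<^sub>\<infinity>(x, y)\<in>X. f x * f y) = infsum f ?G * infsum f ?K"
    if "f \<in> {F3, F1}" for f
  proof -
    have "f summable_on ?G" "f summable_on ?K"
      using summable'[of "\<lambda>_. 1" _ f] that by auto
    then show "(\<lambda>(x, y). f x * f y) summable_on X" "(\<Sum>\<^sub>\<infinity>(x, y)\<in>X. f x * f y) = infsum f ?G * infsum f ?K"
      unfolding X_def by (simp_all add: summable_on_times_complex infsum_times_complex)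
  qed
  have rhs: "(\<lambda>(x, y). f x * f y) summable_on Y"
    "4 * (\<Sum>\<^sub>\<infinity>(x, y)\<in>Y. f x * f y) = (infsum f ?K)\<^sup>2 + (infsum (\<lambda>x. gchar x * f x) ?K)\<^sup>2"
    if f: "f \<in> {H3, H1}" for f
  proof -
    have s: "(\<lambda>x. u x * f x) summable_on ?K" if "\<And>x. cmod (u x) = 1" for u
      by (rule summable'[OF that]) (use f in auto)
    have s1: "f summable_on ?K"
      using s[of "\<lambda>_. 1"] by simp
    have P: "(\<lambda>(x, y). (u x * f x) * (u y * f y)) summable_on ?K \<times> ?K" if "\<And>x. cmod (u x) = 1" for u
      by (intro summable_on_times_complex s that)
    have P1: "(\<lambda>(x, y). f x * f y) summable_on ?K \<times> ?K"
      by (intro summable_on_times_complex s1)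
    then show "(\<lambda>(x, y). f x * f y) summable_on Y"
      by (rule summable_on_subset_banach) (auto simp: Y_def)
    have even: "f (- x) = f x" for x
      using f rotate(3)[of "\<i> * x"] rotate(4)[of "\<i> * x"] by (auto simp: rotate)
    have K_minus: "- x \<in> ?K" if "x \<in> ?K" for x
      using half_gauss_ints_int_diff[OF that, of 0] by (simp add: gauss_ints_def)
    have e_minus: "e1 (- x) = - e1 x" "e2 (- x) = - e2 x" if x_K: "x \<in> ?K" for x
    proof -
      obtain m n where x: "x = Complex (of_int m + 1 / 2) (of_int n + 1 / 2)"
        using x_K by (rule half_gauss_intsE)
      have "- x = Complex (of_int (- 2 * m - 1)) (of_int (- 2 * n - 1)) + x"
        by (simp add: x complex_eq_iff)
      then show "e1 (- x) = - e1 x" "e2 (- x) = - e2 x"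
        by (simp_all only: mults e_int) auto
    qed
    \<comment> \<open>\<open>e1\<close> and \<open>e2\<close> are odd on half-integral points while
      \<open>f\<close> is even, so of the four characters only the trivial one and
      \<open>gchar\<close> contribute.\<close>
    have "infsum (\<lambda>x. e1 x * f x) ?K = 0" "infsum (\<lambda>x. e2 x * f x) ?K = 0"
      by (rule infsum_eq_0_if_odd; simp add: K_minus e_minus even)+
    then have "(infsum f ?K)\<^sup>2 + (infsum (\<lambda>x. gchar x * f x) ?K)\<^sup>2 =
       (infsum f ?K * infsum f ?K + infsum (\<lambda>x. gchar x * f x) ?K * infsum (\<lambda>x. gchar x * f x) ?K)
       + (infsum (\<lambda>x. e1 x * f x) ?K * infsum (\<lambda>x. e1 x * f x) ?K + infsum (\<lambda>x. e2 x * f x) ?K * infsum (\<lambda>x. e2 x * f x) ?K)"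
      by (simp add: power2_eq_square)
    also have "\<dots> = ((\<Sum>\<^sub>\<infinity>(x, y)\<in>?K \<times> ?K. f x * f y) + (\<Sum>\<^sub>\<infinity>(x, y)\<in>?K \<times> ?K. (gchar x * f x) * (gchar y * f y)))
       + ((\<Sum>\<^sub>\<infinity>(x, y)\<in>?K \<times> ?K. (e1 x * f x) * (e1 y * f y)) + (\<Sum>\<^sub>\<infinity>(x, y)\<in>?K \<times> ?K. (e2 x * f x) * (e2 y * f y)))"
      by (simp only: infsum_times_complex s1 s norms)
    also have "\<dots> = (\<Sum>\<^sub>\<infinity>z\<in>?K \<times> ?K. ((case z of (x, y) \<Rightarrow> f x * f y) + (case z of (x, y) \<Rightarrow> (gchar x * f x) * (gchar y * f y)))
       + ((case z of (x, y) \<Rightarrow> (e1 x * f x) * (e1 y * f y)) + (case z of (x, y) \<Rightarrow> (e2 x * f x) * (e2 y * f y))))"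
      by (simp only: infsum_add P1 P norms summable_on_add)
    also have "\<dots> = (\<Sum>\<^sub>\<infinity>z\<in>Y. 4 * (case z of (x, y) \<Rightarrow> f x * f y))"
    proof (rule infsum_cong_neutral)
      \<comment> \<open>Because \<open>gchar = e1 * e2\<close>, the sum of the four characters at
        \<open>x + y\<close> is a product, which is 4 if both coordinates are even and 0
        otherwise.\<close>
      have factor: "((case z of (x, y) \<Rightarrow> f x * f y) + (case z of (x, y) \<Rightarrow> (gchar x * f x) * (gchar y * f y)))
         + ((case z of (x, y) \<Rightarrow> (e1 x * f x) * (e1 y * f y)) + (case z of (x, y) \<Rightarrow> (e2 x * f x) * (e2 y * f y)))
         = (1 + e1 (fst z + snd z)) * (1 + e2 (fst z + snd z)) * (case z of (x, y) \<Rightarrow> f x * f y)" for z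
        by (simp add: mults split_beta algebra_simps)
      have *: "(1 + e1 (x + y)) * (1 + e2 (x + y)) = (if (x + y) / 2 \<in> ?G then 4 else 0)"
        if xy: "x \<in> ?K" "y \<in> ?K" for x y
      proof -
        obtain m n where mn: "x + y = Complex (of_int m) (of_int n)"
          using half_gauss_ints_add[OF xy] by (rule gauss_intsE)
        have "(x + y) / 2 \<in> ?G \<longleftrightarrow> even m \<and> even n"
        proof
          assume "(x + y) / 2 \<in> ?G"
          then obtain k l where "(x + y) / 2 = Complex (of_int k) (of_int l)" by (rule gauss_intsE)
          then have "real_of_int m = of_int (2 * k)" "real_of_int n = of_int (2 * l)"
            by (simp_all add: mn complex_eq_iff)
          then show "even m \<and> even n" by (simp only: of_int_eq_iff) simp
        next
          assume "even m \<and> even n"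
          then obtain k l where "m = 2 * k" "n = 2 * l" by (auto elim!: evenE)
          then have "(x + y) / 2 = Complex (of_int k) (of_int l)" by (simp add: mn complex_eq_iff)
          then show "(x + y) / 2 \<in> ?G" by simp
        qed
        then show ?thesis unfolding mn e_int by auto
      qed
      fix z
      show "((case z of (x, y) \<Rightarrow> f x * f y) + (case z of (x, y) \<Rightarrow> (gchar x * f x) * (gchar y * f y)))
         + ((case z of (x, y) \<Rightarrow> (e1 x * f x) * (e1 y * f y)) + (case z of (x, y) \<Rightarrow> (e2 x * f x) * (e2 y * f y)))
         = 4 * (case z of (x, y) \<Rightarrow> f x * f y)" if "z \<in> ?K \<times> ?K \<inter> Y"
        unfolding factor using that * by (auto simp: Y_def)
      show "((case z of (x, y) \<Rightarrow> f x * f y) + (case z of (x, y) \<Rightarrow> (gchar x * f x) * (gchar y * f y)))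
         + ((case z of (x, y) \<Rightarrow> (e1 x * f x) * (e1 y * f y)) + (case z of (x, y) \<Rightarrow> (e2 x * f x) * (e2 y * f y))) = 0"
        if z: "z \<in> ?K \<times> ?K - Y"
      proof -
        obtain x y where xy: "z = (x, y)" "x \<in> ?K" "y \<in> ?K" "(x + y) / 2 \<notin> ?G"
          using z by (auto simp: Y_def)
        show ?thesis unfolding factor xy(1) fst_conv snd_conv *[OF xy(2,3)] using xy(4) by simp
      qed
    qed (auto simp: Y_def)
    finally show "4 * (\<Sum>\<^sub>\<infinity>(x, y)\<in>Y. f x * f y) = (infsum f ?K)\<^sup>2 + (infsum (\<lambda>x. gchar x * f x) ?K)\<^sup>2"
      by (simp add: infsum_cmult_right')
  qed
  have YX: "((x + y) / 2, (x - y) / 2) \<in> X" if "(x, y) \<in> Y" for x y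
  proof -
    have d: "(x - y) / 2 = (x + y) / 2 - y" by (simp add: field_simps)
    show ?thesis
      using that half_gauss_ints_int_diff[of y "(x + y) / 2"] unfolding d by (simp add: X_def Y_def)
  qed
  have XY: "(a + b, a - b) \<in> Y" if "(a, b) \<in> X" for a b
    using that by (auto simp: X_def Y_def half_gauss_ints_add_int half_gauss_ints_int_diff)
  have "(\<Sum>\<^sub>\<infinity>z\<in>X. (case z of (a, b) \<Rightarrow> F3 a * F3 b) + (case z of (a, b) \<Rightarrow> F1 a * F1 b))
    = (\<Sum>\<^sub>\<infinity>z\<in>Y. (case z of (x, y) \<Rightarrow> H3 x * H3 y) + (case z of (x, y) \<Rightarrow> H1 x * H1 y))"
    by (rule infsum_reindex_bij_witness[of _ "\<lambda>(x, y). ((x + y) / 2, (x - y) / 2)" "\<lambda>(a, b). (a + b, a - b)"])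
      (auto simp: XY YX quartic sum_diff_halves)
  moreover have "(\<Sum>\<^sub>\<infinity>z\<in>X. (case z of (a, b) \<Rightarrow> F3 a * F3 b) + (case z of (a, b) \<Rightarrow> F1 a * F1 b))
     = infsum F3 ?G * infsum F3 ?K + infsum F1 ?G * infsum F1 ?K"
    by (subst infsum_add) (simp_all only: lhs insertI1 insertI2)
  moreover have "(\<Sum>\<^sub>\<infinity>z\<in>Y. (case z of (x, y) \<Rightarrow> H3 x * H3 y) + (case z of (x, y) \<Rightarrow> H1 x * H1 y))
    = (\<Sum>\<^sub>\<infinity>(x, y)\<in>Y. H3 x * H3 y) + (\<Sum>\<^sub>\<infinity>(x, y)\<in>Y. H1 x * H1 y)"
    by (rule infsum_add) (simp_all only: rhs insertI1 insertI2)
  ultimately have "4 * (infsum F3 ?G * infsum F3 ?K) = 4 * (\<Sum>\<^sub>\<infinity>(x, y)\<in>Y. H3 x * H3 y) + 4 * (\<Sum>\<^sub>\<infinity>(x, y)\<in>Y. H1 x * H1 y)"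
    by (simp add: gauss_sum_odd_eq_0)
  then show ?thesis
    by (simp add: rhs gauss_sum_odd_eq_0)
qed

end

subsection \<open>Planar theta sums and their duplication\<close>

definition planar :: "(complex \<Rightarrow> complex) \<Rightarrow> complex \<Rightarrow> complex \<Rightarrow> complex \<Rightarrow> complex \<Rightarrow> complex" where
  "planar th w z y x = exp (of_real pi * w * of_real ((cmod x)\<^sup>2)) * (th (x * z) * th (x * y))"

text \<open>\<open>ThetaP\<close>, \<open>ThetaQ\<close>, \<open>ThetaR\<close>,
  \<open>ThetaS\<close> are the planar forms of the theta constants with characteristics
  \<open>0000,0000\<close>, \<open>1100,0000\<close>, \<open>0000,1100\<close>,
  \<open>1111,1111\<close>, in this order.\<close>

definition ThetaP :: "complex \<Rightarrow> complex \<Rightarrow> complex \<Rightarrow> complex" where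
  "ThetaP w z y = infsum (planar theta3 w z y) gauss_ints"

definition ThetaQ :: "complex \<Rightarrow> complex \<Rightarrow> complex \<Rightarrow> complex" where
  "ThetaQ w z y = infsum (planar theta3 w z y) half_gauss_ints"

definition ThetaR :: "complex \<Rightarrow> complex \<Rightarrow> complex \<Rightarrow> complex" where
  "ThetaR w z y = infsum (\<lambda>x. gchar x * planar theta3 w z y x) gauss_ints"

definition ThetaS :: "complex \<Rightarrow> complex \<Rightarrow> complex \<Rightarrow> complex" where
  "ThetaS w z y = infsum (\<lambda>x. gchar x * planar theta1 w z y x) half_gauss_ints"

text \<open>Negativity of the hermitian form at the vector \<open>(1, w, z, y)\<close>.\<close>

definition in_ball :: "complex \<Rightarrow> complex \<Rightarrow> complex \<Rightarrow> bool" where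
  "in_ball w z y \<longleftrightarrow> 2 * Re w + (cmod z)\<^sup>2 + (cmod y)\<^sup>2 < 0"

section \<open>Convergence of the planar sums\<close>

lemma summable_on_exp_square:
  fixes k :: real
  assumes "k > 0" "A \<in> {\<int>, half_ints}"
  shows "(\<lambda>x. exp (- k * x\<^sup>2)) summable_on A"
proof -
  have "(\<lambda>n::int. exp (- k * (of_int n + 1 / 2)\<^sup>2)) summable_on UNIV"
  proof (rule summable_on_comparison_test)
    show "(\<lambda>n. exp (k / 2) * exp (- (k / 2) * (real_of_int n)\<^sup>2)) summable_on UNIV"
      using assms by (intro summable_on_cmult_right summable_on_exp_int_square) auto
    fix n :: int
    have "0 \<le> (real_of_int n + 1)\<^sup>2" by simp
    then have "(real_of_int n)\<^sup>2 / 2 - 1 / 2 \<le> (of_int n + 1 / 2)\<^sup>2"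
      by (simp add: power2_eq_square field_simps)
    then have "k * ((real_of_int n)\<^sup>2 / 2 - 1 / 2) \<le> k * (of_int n + 1 / 2)\<^sup>2"
      using assms by (intro mult_left_mono) auto
    then show "exp (- k * (of_int n + 1 / 2)\<^sup>2) \<le> exp (k / 2) * exp (- (k / 2) * (real_of_int n)\<^sup>2)"
      unfolding exp_add[symmetric] exp_le_cancel_iff by (simp add: algebra_simps)
  qed auto
  then show ?thesis
    using assms summable_on_exp_int_square[of k] by (auto simp: summable_on_Ints summable_on_half_ints)
qed

lemma summable_on_exp_norm_square:
  fixes k :: real
  assumes "k > 0"
  shows "(\<lambda>x. exp (- k * (cmod x)\<^sup>2)) summable_on gauss_ints \<union> half_gauss_ints"
proof -
  have *: "(\<lambda>x. exp (- k * (cmod x)\<^sup>2)) summable_on {x. Re x \<in> A \<and> Im x \<in> A}" if "A \<in> {\<int>, half_ints}" for A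
  proof -
    have 1: "(\<lambda>x. complex_of_real (exp (- k * x\<^sup>2))) summable_on A"
      by (rule summable_on_of_real[OF summable_on_exp_square[OF assms that]])
    have "(\<lambda>z. cmod (case z of (x, y) \<Rightarrow> complex_of_real (exp (- k * x\<^sup>2)) * complex_of_real (exp (- k * y\<^sup>2)))) summable_on A \<times> A"
      using summable_on_times_complex[OF 1 1] unfolding summable_on_iff_abs_summable_on_complex .
    also have "?this \<longleftrightarrow> (\<lambda>z. exp (- k * (cmod z)\<^sup>2)) summable_on {x. Re x \<in> A \<and> Im x \<in> A}"
      by (rule summable_on_reindex_bij_witness[of _ "\<lambda>z. (Re z, Im z)" "\<lambda>(x, y). Complex x y"])
        (auto simp: cmod_power2 norm_mult algebra_simps simp flip: exp_add)
    finally show ?thesis .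
  qed
  show ?thesis
    using *[of \<int>] *[of half_ints] unfolding gauss_ints_def half_gauss_ints_def by (intro summable_on_union) auto
qed

text \<open>The growth of the two theta factors and the decay of the exponential combine to
  \<open>exp (- k * (cmod x)\<^sup>2)\<close>, and \<open>in_ball\<close> says exactly that
  \<open>k\<close> is positive. The function \<open>th\<close> is kept general so that sums of norms
  can be inserted as well.\<close>

lemma planar_summable_if_bounded:
  assumes "in_ball w z y" and C: "\<And>c. cmod (th c) \<le> C * exp (pi / 2 * (cmod c)\<^sup>2)"
  shows "planar th w z y summable_on gauss_ints \<union> half_gauss_ints"
proof -
  have "C \<ge> 0"
    using order_trans[OF norm_ge_zero C[of 0]] by simp
  define k where "k = - pi * (Re w + ((cmod z)\<^sup>2 + (cmod y)\<^sup>2) / 2)"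
  have "k > 0"
    unfolding k_def
  proof (rule mult_neg_neg)
    show "Re w + ((cmod z)\<^sup>2 + (cmod y)\<^sup>2) / 2 < 0"
      using assms(1) unfolding in_ball_def by (simp add: field_simps)
  qed auto
  have "cmod (planar th w z y x) \<le> C * C * exp (- k * (cmod x)\<^sup>2)" for x
  proof -
    have "cmod (planar th w z y x) = exp (pi * Re w * (cmod x)\<^sup>2) * (cmod (th (x * z)) * cmod (th (x * y)))"
      by (simp add: planar_def norm_mult)
    also have "\<dots> \<le> exp (pi * Re w * (cmod x)\<^sup>2) *
       ((C * exp (pi / 2 * (cmod (x * z))\<^sup>2)) * (C * exp (pi / 2 * (cmod (x * y))\<^sup>2)))"
      using C \<open>C \<ge> 0\<close> by (intro mult_left_mono mult_mono) auto
    also have "\<dots> = C * C * (exp (pi * Re w * (cmod x)\<^sup>2) * exp (pi / 2 * (cmod (x * z))\<^sup>2) * exp (pi / 2 * (cmod (x * y))\<^sup>2))"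
      by simp
    also have "\<dots> = C * C * exp (- k * (cmod x)\<^sup>2)"
      unfolding exp_add[symmetric] k_def by (simp add: norm_mult power_mult_distrib field_simps)
    finally show ?thesis .
  qed
  then have "(\<lambda>x. cmod (planar th w z y x)) summable_on gauss_ints \<union> half_gauss_ints"
    by (intro Infinite_Sum.abs_summable_on_comparison_test'[OF summable_on_cmult_right[OF summable_on_exp_norm_square[OF \<open>k > 0\<close>]]])
  then show ?thesis by (rule abs_summable_summable)
qed

lemma planar_summable:
  "in_ball w z y \<Longrightarrow> th \<in> {theta3, theta1} \<Longrightarrow> planar th w z y summable_on gauss_ints \<union> half_gauss_ints"
  using norm_theta_bounded planar_summable_if_bounded by (metis insert_iff singletonD)

section \<open>Duplication formulas for the planar sums\<close>

lemma parallelogram_complex: "(cmod (z + y))\<^sup>2 + (cmod (z - y))\<^sup>2 = 2 * (cmod z)\<^sup>2 + 2 * (cmod y)\<^sup>2"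
  unfolding cmod_power2 by (simp add: power2_eq_square algebra_simps)

lemma in_ball_duplicate: "in_ball w z y \<Longrightarrow> in_ball (2 * w) (z + y) (z - y)"
  using parallelogram_complex[of z y] by (simp add: in_ball_def)

lemma planar_rotate:
  "planar theta3 w z y (\<i> * x) = planar theta3 w z y x" "planar theta1 w z y (\<i> * x) = - planar theta1 w z y x"
proof -
  have "\<i> * a * (\<i> * b) = - (a * b)" for a b
    by (simp add: complex_eq_iff algebra_simps)
  then show "planar theta3 w z y (\<i> * x) = planar theta3 w z y x"
      "planar theta1 w z y (\<i> * x) = - planar theta1 w z y x"
    by (simp_all add: planar_def norm_mult mult.assoc[of \<i> x] theta3_rotate theta1_rotate)
qed

text \<open>The exponential factors match by the parallelogram law for \<open>a\<close> and
  \<open>b\<close>, and the theta factors are \<open>theta_quartic\<close> at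
  \<open>p = a * z\<close>, \<open>q = a * y\<close>, \<open>r = b * z\<close>,
  \<open>s = b * y\<close>.\<close>

lemma planar_quartic:
  assumes "in_ball w z y"
  shows "lattice_quartic (planar theta3 (2 * w) (z + y) (z - y)) (planar theta1 (2 * w) (z + y) (z - y))
    (planar theta3 w z y) (planar theta1 w z y)"
proof
  fix a b :: complex
  define e where "e = exp (of_real pi * w * of_real ((cmod (a + b))\<^sup>2)) * exp (of_real pi * w * of_real ((cmod (a - b))\<^sup>2))"
  have "exp (of_real pi * (2 * w) * of_real ((cmod a)\<^sup>2)) * exp (of_real pi * (2 * w) * of_real ((cmod b)\<^sup>2))
    = exp (of_real pi * w * of_real (2 * (cmod a)\<^sup>2 + 2 * (cmod b)\<^sup>2))"
    by (simp add: algebra_simps flip: exp_add)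
  also have "\<dots> = e"
    unfolding parallelogram_complex[symmetric] e_def by (simp add: algebra_simps flip: exp_add)
  finally have e: "exp (of_real pi * (2 * w) * of_real ((cmod a)\<^sup>2)) * exp (of_real pi * (2 * w) * of_real ((cmod b)\<^sup>2)) = e" .
  have lhs: "planar th (2 * w) (z + y) (z - y) a * planar th (2 * w) (z + y) (z - y) b =
     e * (th (a * z + a * y) * th (a * z - a * y) * th (b * z + b * y) * th (b * z - b * y))" for th
    unfolding planar_def e[symmetric] by (simp add: distrib_left right_diff_distrib mult_ac)
  have rhs: "planar th w z y (a + b) * planar th w z y (a - b) =
     e * (th (a * z + b * z) * th (a * z - b * z) * th (a * y + b * y) * th (a * y - b * y))" for th
    unfolding planar_def e_def distrib_right left_diff_distrib by (simp add: mult_ac)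
  show "planar theta3 (2 * w) (z + y) (z - y) a * planar theta3 (2 * w) (z + y) (z - y) b
    + planar theta1 (2 * w) (z + y) (z - y) a * planar theta1 (2 * w) (z + y) (z - y) b
    = planar theta3 w z y (a + b) * planar theta3 w z y (a - b) + planar theta1 w z y (a + b) * planar theta1 w z y (a - b)"
    using arg_cong[OF theta_quartic[of "a * z" "a * y" "b * z" "b * y"], of "\<lambda>t. e * t"]
    unfolding lhs rhs distrib_left[of e] .
qed (use assms in \<open>simp_all add: planar_summable in_ball_duplicate planar_rotate\<close>)

lemma
  assumes "in_ball w z y"
  shows duplication_even: "2 * ((ThetaP (2 * w) (z + y) (z - y))\<^sup>2 + (ThetaQ (2 * w) (z + y) (z - y))\<^sup>2) = (ThetaP w z y)\<^sup>2 + (ThetaR w z y)\<^sup>2"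
    and duplication_product: "4 * (ThetaP (2 * w) (z + y) (z - y) * ThetaQ (2 * w) (z + y) (z - y)) = (ThetaQ w z y)\<^sup>2 + (ThetaS w z y)\<^sup>2"
    and duplication_character: "(ThetaR (2 * w) (z + y) (z - y))\<^sup>2 + (ThetaS (2 * w) (z + y) (z - y))\<^sup>2 = ThetaP w z y * ThetaR w z y"
proof -
  interpret lattice_quartic "planar theta3 (2 * w) (z + y) (z - y)" "planar theta1 (2 * w) (z + y) (z - y)"
    "planar theta3 w z y" "planar theta1 w z y"
    by (rule planar_quartic[OF assms])
  show "2 * ((ThetaP (2 * w) (z + y) (z - y))\<^sup>2 + (ThetaQ (2 * w) (z + y) (z - y))\<^sup>2) = (ThetaP w z y)\<^sup>2 + (ThetaR w z y)\<^sup>2"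
    "4 * (ThetaP (2 * w) (z + y) (z - y) * ThetaQ (2 * w) (z + y) (z - y)) = (ThetaQ w z y)\<^sup>2 + (ThetaS w z y)\<^sup>2"
    "(ThetaR (2 * w) (z + y) (z - y))\<^sup>2 + (ThetaS (2 * w) (z + y) (z - y))\<^sup>2 = ThetaP w z y * ThetaR w z y"
    unfolding ThetaP_def ThetaQ_def ThetaR_def ThetaS_def by (fact even_duplication product_duplication character_duplication)+
qed

lemma theta_rotate_right:
  "ThetaP w z (\<i> * y) = ThetaP w z y" "ThetaQ w z (\<i> * y) = ThetaQ w z y" "ThetaR w z (\<i> * y) = ThetaR w z y" "ThetaS w z (\<i> * y) = \<i> * ThetaS w z y"
proof -
  have 3: "planar theta3 w z (\<i> * y) x = planar theta3 w z y x" for x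
    using theta3_rotate[of "x * y"] by (simp add: planar_def mult.left_commute)
  then have 3: "planar theta3 w z (\<i> * y) = planar theta3 w z y" by (rule ext)
  have 1: "planar theta1 w z (\<i> * y) x = \<i> * planar theta1 w z y x" for x
    using theta1_rotate[of "x * y"] by (simp add: planar_def mult.left_commute)
  show "ThetaP w z (\<i> * y) = ThetaP w z y" "ThetaQ w z (\<i> * y) = ThetaQ w z y" "ThetaR w z (\<i> * y) = ThetaR w z y" "ThetaS w z (\<i> * y) = \<i> * ThetaS w z y"
    by (simp_all add: ThetaP_def ThetaQ_def ThetaR_def ThetaS_def 3 1 mult.left_commute infsum_cmult_right')
qed

lemma theta_swap: "ThetaP w y z = ThetaP w z y" "ThetaQ w y z = ThetaQ w z y" "ThetaR w y z = ThetaR w z y" "ThetaS w y z = ThetaS w z y"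
proof -
  have "planar th w y z = planar th w z y" for th
    by (rule ext) (simp add: planar_def mult.commute)
  then show "ThetaP w y z = ThetaP w z y" "ThetaQ w y z = ThetaQ w z y" "ThetaR w y z = ThetaR w z y" "ThetaS w y z = ThetaS w z y"
    by (simp_all add: ThetaP_def ThetaQ_def ThetaR_def ThetaS_def)
qed

text \<open>On Gaussian integers, \<open>1 + gchar\<close> is twice the indicator of the multiples
  of \<open>1 + \<i>\<close>, and \<open>1 - gchar\<close> that of the others, which are
  \<open>1 + \<i>\<close> times \<open>half_gauss_ints\<close>. Multiplication by
  \<open>1 + \<i>\<close> doubles the squared modulus and so turns \<open>w\<close> into
  \<open>2 * w\<close>.\<close>

lemma
  assumes "in_ball w z y"
  shows P_plus_R: "ThetaP w z y + ThetaR w z y = 2 * ThetaP (2 * w) ((1 + \<i>) * z) ((1 + \<i>) * y)"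
    and P_minus_R: "ThetaP w z y - ThetaR w z y = 2 * ThetaQ (2 * w) ((1 + \<i>) * z) ((1 + \<i>) * y)"
proof -
  let ?G = gauss_ints and ?K = half_gauss_ints
  let ?f = "planar theta3 w z y"
  define g where "g = planar theta3 (2 * w) ((1 + \<i>) * z) ((1 + \<i>) * y)"
  have f: "?f summable_on ?G"
    by (rule summable_on_subset_banach[OF planar_summable[OF assms]]) auto
  have "(\<lambda>x. cmod (?f x)) summable_on ?G"
    using f by (simp only: summable_on_iff_abs_summable_on_complex)
  then have "(\<lambda>x. cmod (gchar x * ?f x)) summable_on ?G"
    by (simp add: norm_mult gchar_def)
  then have cf: "(\<lambda>x. gchar x * ?f x) summable_on ?G"
    by (rule abs_summable_summable)
  have gf: "?f ((1 + \<i>) * x) = g x" for x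
  proof -
    have "(cmod ((1 + \<i>) * x))\<^sup>2 = 2 * (cmod x)\<^sup>2"
      by (simp add: norm_mult power_mult_distrib cmod_power2)
    then show ?thesis by (simp add: g_def planar_def mult_ac)
  qed
  have inv: "(1 - \<i>) / 2 * ((1 + \<i>) * x) = x" "(1 + \<i>) * ((1 - \<i>) / 2 * x) = x" for x
    by (simp_all add: complex_eq_iff field_simps)
  have int: "(1 + \<i>) * x \<in> ?G" "gchar ((1 + \<i>) * x) = 1" if "x \<in> ?G" for x
    using rotate_gauss_ints[OF that] that gchar_square[of x] 
    by (auto simp: distrib_right gchar_add gchar_rotate_int)
  have half: "(1 + \<i>) * x \<in> ?G" "gchar ((1 + \<i>) * x) = - 1" if "x \<in> ?K" for x
    using rotate_half_gauss_ints[OF that] that gchar_square[of x] 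
    by (auto simp: distrib_right gchar_add gchar_rotate_half half_gauss_ints_add)
  have mem: "(gchar x = 1 \<longrightarrow> (1 - \<i>) / 2 * x \<in> ?G) \<and> (gchar x = - 1 \<longrightarrow> (1 - \<i>) / 2 * x \<in> ?K)" if x: "x \<in> ?G" for x
  proof -
    obtain m n where mn: "x = Complex (of_int m) (of_int n)" using x by (rule gauss_intsE)
    have eq: "(1 - \<i>) / 2 * x = Complex (of_int (m + n) / 2) (of_int (n - m) / 2)"
      by (simp add: mn complex_eq_iff field_simps)
    have gx: "gchar x = (if even (m + n) then 1 else - 1)"
      by (simp add: mn gchar_Complex_int)
    show ?thesis
    proof (cases "even (m + n)")
      case True
      then obtain k where k: "m + n = 2 * k" by blast
      then have nm: "real_of_int (n - m) = 2 * of_int (k - m)" by simp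
      have "(1 - \<i>) / 2 * x = Complex (of_int k) (of_int (k - m))"
        unfolding eq k nm by simp
      then show ?thesis using True gx by (simp only: Complex_in_gauss_ints) simp
    next
      case False
      then obtain k where k: "m + n = 2 * k + 1" by (rule oddE)
      then have nm: "n - m = 2 * (k - m) + 1" by simp
      have "of_int (2 * l + 1) / 2 = (of_int l + 1 / 2 :: real)" for l by simp
      then show ?thesis using False unfolding eq gx k nm by (simp only: Complex_in_half_gauss_ints) auto
    qed
  qed
  have chi: "gchar x = 1 \<or> gchar x = - 1" if "x \<in> ?G" for x
    using gchar_square[of x] that by (simp add: square_eq_1_iff)
  have "ThetaP w z y + ThetaR w z y = (\<Sum>\<^sub>\<infinity>x\<in>?G. ?f x + gchar x * ?f x)"
    unfolding ThetaP_def ThetaR_def by (rule infsum_add[OF f cf, symmetric])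
  also have "\<dots> = (\<Sum>\<^sub>\<infinity>x\<in>{x \<in> ?G. gchar x = 1}. 2 * ?f x)"
    by (rule infsum_cong_neutral) (auto dest: chi)
  also have "\<dots> = (\<Sum>\<^sub>\<infinity>x\<in>?G. 2 * g x)"
    by (rule infsum_reindex_bij_witness[of _ "\<lambda>x. (1 + \<i>) * x" "\<lambda>x. (1 - \<i>) / 2 * x"])
      (use mem int in \<open>simp_all only: inv mem_Collect_eq gf[symmetric]\<close>)
  finally show "ThetaP w z y + ThetaR w z y = 2 * ThetaP (2 * w) ((1 + \<i>) * z) ((1 + \<i>) * y)"
    by (simp add: ThetaP_def g_def infsum_cmult_right')
  have "ThetaP w z y - ThetaR w z y = ThetaP w z y + (\<Sum>\<^sub>\<infinity>x\<in>?G. - (gchar x * ?f x))"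
    by (simp add: ThetaR_def infsum_uminus)
  also have "\<dots> = (\<Sum>\<^sub>\<infinity>x\<in>?G. ?f x + - (gchar x * ?f x))"
    unfolding ThetaP_def by (rule infsum_add[symmetric]) (simp_all add: f cf summable_on_uminus)
  also have "\<dots> = (\<Sum>\<^sub>\<infinity>x\<in>{x \<in> ?G. gchar x = - 1}. 2 * ?f x)"
    by (rule infsum_cong_neutral) (auto dest: chi)
  also have "\<dots> = (\<Sum>\<^sub>\<infinity>x\<in>?K. 2 * g x)"
    by (rule infsum_reindex_bij_witness[of _ "\<lambda>x. (1 + \<i>) * x" "\<lambda>x. (1 - \<i>) / 2 * x"])
      (use mem half in \<open>simp_all only: inv mem_Collect_eq gf[symmetric]\<close>)
  finally show "ThetaP w z y - ThetaR w z y = 2 * ThetaQ (2 * w) ((1 + \<i>) * z) ((1 + \<i>) * y)"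
    by (simp add: ThetaQ_def g_def infsum_cmult_right')
qed

text \<open>The first three relations are the duplication formulas at
  \<open>(w, z, \<i> * y)\<close>. The fourth compares two different duplications that lead to
  related points.\<close>

lemma
  assumes "in_ball w z y"
  defines "ThetaP' \<equiv> ThetaP (2 * w) (z - \<i> * y) (y - \<i> * z)" and "ThetaQ' \<equiv> ThetaQ (2 * w) (z - \<i> * y) (y - \<i> * z)"
    and "ThetaR' \<equiv> ThetaR (2 * w) (z - \<i> * y) (y - \<i> * z)" and "ThetaS' \<equiv> ThetaS (2 * w) (z - \<i> * y) (y - \<i> * z)"
  shows mean_even: "2 * (ThetaP'\<^sup>2 + ThetaQ'\<^sup>2) = (ThetaP w z y)\<^sup>2 + (ThetaR w z y)\<^sup>2"
    and mean_product: "4 * (ThetaP' * ThetaQ') = (ThetaQ w z y)\<^sup>2 - (ThetaS w z y)\<^sup>2"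
    and mean_character: "ThetaR'\<^sup>2 - ThetaS'\<^sup>2 = ThetaP w z y * ThetaR w z y"
    and mean_character_square: "4 * (ThetaR'\<^sup>2 + ThetaS'\<^sup>2)\<^sup>2 = ((ThetaP w z y)\<^sup>2 + (ThetaR w z y)\<^sup>2)\<^sup>2 - ((ThetaQ w z y)\<^sup>2 + (ThetaS w z y)\<^sup>2)\<^sup>2"
proof -
  have b: "in_ball w z (\<i> * y)" using assms(1) by (simp add: in_ball_def norm_mult)
  \<comment> \<open>The duplicated point is the mean point up to a swap and a rotation. Only
    \<open>ThetaS\<close> changes, by the factor \<open>\<i>\<close>, so its square changes
    sign.\<close>
  have eq: "z + \<i> * y = \<i> * (y - \<i> * z)" by (simp add: complex_eq_iff)
  have *: "ThetaP (2 * w) (z + \<i> * y) (z - \<i> * y) = ThetaP'" "ThetaQ (2 * w) (z + \<i> * y) (z - \<i> * y) = ThetaQ'"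
    "ThetaR (2 * w) (z + \<i> * y) (z - \<i> * y) = ThetaR'" "ThetaS (2 * w) (z + \<i> * y) (z - \<i> * y) = \<i> * ThetaS'"
    unfolding eq ThetaP'_def ThetaQ'_def ThetaR'_def ThetaS'_def by (subst theta_swap, simp only: theta_rotate_right)+
  show "2 * (ThetaP'\<^sup>2 + ThetaQ'\<^sup>2) = (ThetaP w z y)\<^sup>2 + (ThetaR w z y)\<^sup>2"
    using duplication_even[OF b] unfolding * by (simp add: theta_rotate_right)
  show "4 * (ThetaP' * ThetaQ') = (ThetaQ w z y)\<^sup>2 - (ThetaS w z y)\<^sup>2"
    using duplication_product[OF b] unfolding * by (simp add: theta_rotate_right power_mult_distrib)
  show "ThetaR'\<^sup>2 - ThetaS'\<^sup>2 = ThetaP w z y * ThetaR w z y"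
    using duplication_character[OF b] unfolding * by (simp add: theta_rotate_right power_mult_distrib)
  define p q where "p = ThetaP (2 * w) (z + y) (z - y)" and "q = ThetaQ (2 * w) (z + y) (z - y)"
  \<comment> \<open>\<open>(2w, z - \<i> y, y - \<i> z)\<close> is also the duplication of \<open>(w, z', y')\<close>, where \<open>ThetaP\<close> and \<open>ThetaR\<close> can be evaluated
    by \<open>P_plus_R\<close> and \<open>P_minus_R\<close>.\<close>
  define z' y' where "z' = (1 - \<i>) / 2 * (z + y)" and "y' = (1 + \<i>) / 2 * (z - y)"
  have b': "in_ball w z' y'"
  proof -
    have "(cmod z')\<^sup>2 + (cmod y')\<^sup>2 = ((cmod (z + y))\<^sup>2 + (cmod (z - y))\<^sup>2) / 2"
      by (simp add: z'_def y'_def norm_mult norm_divide power_mult_distrib power_divide cmod_power2[of "1 + \<i>"] cmod_power2[of "1 - \<i>"])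
    then show ?thesis
      using assms(1) parallelogram_complex[of z y] by (simp add: in_ball_def)
  qed
  have "z' + y' = z - \<i> * y" "z' - y' = y - \<i> * z"
    by (simp_all add: z'_def y'_def complex_eq_iff field_simps)
  then have "ThetaR'\<^sup>2 + ThetaS'\<^sup>2 = ThetaP w z' y' * ThetaR w z' y'"
    using duplication_character[OF b'] by (simp add: ThetaR'_def ThetaS'_def)
  also have "\<dots> = (p + q) * (p - q)"
  proof -
    have eqs: "(1 + \<i>) * z' = z + y" "(1 + \<i>) * y' = \<i> * (z - y)"
      by (simp_all add: z'_def y'_def complex_eq_iff field_simps)
    have "ThetaP w z' y' + ThetaR w z' y' = 2 * p" "ThetaP w z' y' - ThetaR w z' y' = 2 * q"
      using P_plus_R[OF b'] P_minus_R[OF b'] unfolding eqs theta_rotate_right p_def q_def by simp_all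
    then have "ThetaP w z' y' = p + q" "ThetaR w z' y' = p - q"
      by algebra+
    then show ?thesis by simp
  qed
  finally have "ThetaR'\<^sup>2 + ThetaS'\<^sup>2 = (p + q) * (p - q)" .
  moreover have "2 * (p\<^sup>2 + q\<^sup>2) = (ThetaP w z y)\<^sup>2 + (ThetaR w z y)\<^sup>2" "4 * (p * q) = (ThetaQ w z y)\<^sup>2 + (ThetaS w z y)\<^sup>2"
    unfolding p_def q_def by (rule duplication_even[OF assms(1)] duplication_product[OF assms(1)])+
  \<comment> \<open>Uses \<open>4 * (p\<^sup>2 - q\<^sup>2)\<^sup>2 = (2 * (p\<^sup>2 +
    q\<^sup>2))\<^sup>2 - (4 * p * q)\<^sup>2\<close>.\<close>
  ultimately show "4 * (ThetaR'\<^sup>2 + ThetaS'\<^sup>2)\<^sup>2 = ((ThetaP w z y)\<^sup>2 + (ThetaR w z y)\<^sup>2)\<^sup>2 - ((ThetaQ w z y)\<^sup>2 + (ThetaS w z y)\<^sup>2)\<^sup>2"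
    by algebra
qed

subsection \<open>Theta constants on the ball\<close>

lemma of_real_infsum:
  "f summable_on A \<Longrightarrow> complex_of_real (infsum f A) = (\<Sum>\<^sub>\<infinity>x\<in>A. of_real (f x))"
  by (rule infsumI[symmetric]) (rule has_sum_of_real[OF has_sum_infsum])

text \<open>Fubini for the absolutely summable triple series, with \<open>x\<close> and
  \<open>x'\<close> summed first. The unimodular weights \<open>u\<close> and \<open>t\<close> carry
  the characters.\<close>

lemma infsum_planar_series:
  assumes ball: "in_ball w z y" and A: "A \<in> {gauss_ints, half_gauss_ints}" and B: "B \<in> {\<int>, half_ints}"
    and u: "\<And>x. cmod (u x) = 1" and t: "\<And>x. cmod (t x) = 1"
    and th: "\<And>c. th c = (\<Sum>\<^sub>\<infinity>x\<in>B. t x * gterm c x)"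
  shows "(\<Sum>\<^sub>\<infinity>(\<xi>, x, x')\<in>A \<times> (B \<times> B). u \<xi> * (exp (of_real pi * w * of_real ((cmod \<xi>)\<^sup>2)) *
      ((t x * gterm (\<xi> * z) x) * (t x' * gterm (\<xi> * y) x')))) = (\<Sum>\<^sub>\<infinity>\<xi>\<in>A. u \<xi> * planar th w z y \<xi>)"
proof -
  define f where "f = (\<lambda>(\<xi>, x, x'). u \<xi> * (exp (of_real pi * w * of_real ((cmod \<xi>)\<^sup>2)) *
      ((t x * gterm (\<xi> * z) x) * (t x' * gterm (\<xi> * y) x'))))"
  \<comment> \<open>\<open>N\<close> obeys the same growth bound as the theta functions, so its
    planar sum converges and yields absolute summability of the triple series.\<close>
  define N where "N c = (\<Sum>\<^sub>\<infinity>x\<in>B. cmod (gterm c x))" for c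
  obtain C where C: "N c \<le> C * exp (pi / 2 * (cmod c)\<^sup>2)" for c
    using gterm_norm_sum_bounded B unfolding N_def by blast
  have N_nonneg: "N c \<ge> 0" for c
    unfolding N_def by (intro infsum_nonneg) auto
  have gt: "(\<lambda>x. t x * gterm c x) summable_on B" for c
    by (rule abs_summable_summable) (use gterm_norm_summable[OF B] in \<open>simp add: norm_mult t\<close>)
  have "planar (\<lambda>c. of_real (N c)) w z y summable_on gauss_ints \<union> half_gauss_ints"
    by (rule planar_summable_if_bounded[OF ball, of _ C]) (simp only: norm_of_real abs_of_nonneg[OF N_nonneg] C)
  then have "planar (\<lambda>c. of_real (N c)) w z y summable_on A"
    by (rule summable_on_subset_banach) (use A in auto)
  then have outer: "(\<lambda>\<xi>. cmod (planar (\<lambda>c. of_real (N c)) w z y \<xi>)) summable_on A"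
    by (simp only: summable_on_iff_abs_summable_on_complex)
  have "(\<lambda>p. cmod (f p)) summable_on A \<times> (B \<times> B)"
  proof (rule summable_on_SigmaI[OF _ outer])
    fix \<xi>
    have sum: "(\<lambda>(x, x'). (t x * gterm (\<xi> * z) x) * (t x' * gterm (\<xi> * y) x')) summable_on B \<times> B"
      by (intro summable_on_times_complex gt)
    then have sum': "(\<lambda>p. cmod (case p of (x, x') \<Rightarrow> (t x * gterm (\<xi> * z) x) * (t x' * gterm (\<xi> * y) x'))) summable_on B \<times> B"
      by (simp only: summable_on_iff_abs_summable_on_complex)
    have "(\<lambda>x. complex_of_real (cmod (gterm c x))) summable_on B" for c
      by (rule summable_on_of_real[OF gterm_norm_summable[OF B]])
    from infsum_times_complex[OF this this, of "\<xi> * z" "\<xi> * y"]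
    have "of_real (N (\<xi> * z)) * of_real (N (\<xi> * y)) = (\<Sum>\<^sub>\<infinity>(x, x')\<in>B \<times> B. complex_of_real (cmod (gterm (\<xi> * z) x)) * of_real (cmod (gterm (\<xi> * y) x')))"
      unfolding N_def of_real_infsum[OF gterm_norm_summable[OF B]] .
    also have "\<dots> = of_real (\<Sum>\<^sub>\<infinity>p\<in>B \<times> B. cmod (case p of (x, x') \<Rightarrow> (t x * gterm (\<xi> * z) x) * (t x' * gterm (\<xi> * y) x')))"
      unfolding of_real_infsum[OF sum'] by (intro infsum_cong) (auto simp: norm_mult t)
    finally have "N (\<xi> * z) * N (\<xi> * y) = (\<Sum>\<^sub>\<infinity>p\<in>B \<times> B. cmod (case p of (x, x') \<Rightarrow> (t x * gterm (\<xi> * z) x) * (t x' * gterm (\<xi> * y) x')))"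
      by (simp only: of_real_mult[symmetric] of_real_eq_iff)
    with has_sum_infsum[OF sum'] have "((\<lambda>p. cmod (case p of (x, x') \<Rightarrow> (t x * gterm (\<xi> * z) x) * (t x' * gterm (\<xi> * y) x'))) has_sum N (\<xi> * z) * N (\<xi> * y)) (B \<times> B)"
      by simp
    from has_sum_cmult_right[OF this, of "cmod (exp (of_real pi * w * of_real ((cmod \<xi>)\<^sup>2)))"]
    show "((\<lambda>p. cmod (f (\<xi>, p))) has_sum cmod (planar (\<lambda>c. of_real (N c)) w z y \<xi>)) (B \<times> B)"
      by (simp add: f_def planar_def norm_mult u N_nonneg split_beta)
  qed auto
  then have f: "f summable_on A \<times> (B \<times> B)"
    by (rule abs_summable_summable)
  have inner: "(\<Sum>\<^sub>\<infinity>p\<in>B \<times> B. f (\<xi>, p)) = u \<xi> * planar th w z y \<xi>" for \<xi>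
  proof -
    have "(\<Sum>\<^sub>\<infinity>p\<in>B \<times> B. f (\<xi>, p)) = (\<Sum>\<^sub>\<infinity>p\<in>B \<times> B. (u \<xi> * exp (of_real pi * w * of_real ((cmod \<xi>)\<^sup>2))) *
      (case p of (x, x') \<Rightarrow> (t x * gterm (\<xi> * z) x) * (t x' * gterm (\<xi> * y) x')))"
      by (intro infsum_cong) (auto simp: f_def)
    also have "\<dots> = u \<xi> * planar th w z y \<xi>"
      unfolding infsum_cmult_right' infsum_times_complex[OF gt gt, symmetric] th[symmetric] planar_def by simp
    finally show ?thesis .
  qed
  from f have "infsum f (A \<times> (B \<times> B)) = (\<Sum>\<^sub>\<infinity>\<xi>\<in>A. \<Sum>\<^sub>\<infinity>p\<in>B \<times> B. f (\<xi>, p))"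
    by (rule infsum_Sigma_banach[symmetric])
  also have "\<dots> = (\<Sum>\<^sub>\<infinity>\<xi>\<in>A. u \<xi> * planar th w z y \<xi>)"
    by (simp only: inner)
  finally show ?thesis by (simp add: f_def)
qed

definition ball_point :: "complex \<Rightarrow> complex \<Rightarrow> complex \<Rightarrow> complex^4" where
  "ball_point w z y = vector [1, w, z, y]"

text \<open>Closed form of the modified period matrix in the affine chart. The lower right block is
  \<open>\<i>\<close> times the identity, which is why Jacobi theta functions at \<open>\<i>\<close>
  appear.\<close>

definition sharp_mat :: "complex \<Rightarrow> complex \<Rightarrow> complex \<Rightarrow> complex^4^4" where
  "sharp_mat w z y = (let e = (z\<^sup>2 + y\<^sup>2) / 2 in vector [
     vector [- \<i> * (w - e), - e, - \<i> * z, - \<i> * y],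
     vector [- e, - \<i> * (w + e), z, y],
     vector [- \<i> * z, z, \<i>, 0],
     vector [- \<i> * y, y, 0, \<i>]])"

text \<open>The real part of this bilinear form value is at most the hermitian form value, which is
  negative.\<close>

lemma in_ball_denominator:
  assumes "in_ball w z y"
  shows "2 * w + z\<^sup>2 + y\<^sup>2 \<noteq> 0"
proof
  assume "2 * w + z\<^sup>2 + y\<^sup>2 = 0"
  then have "Re (2 * w) + Re (z\<^sup>2) + Re (y\<^sup>2) = 0"
    by (simp only: plus_complex.sel[symmetric] zero_complex.sel)
  moreover have "Re (2 * w) = 2 * Re w" by simp
  moreover have "Re (c\<^sup>2) \<le> (cmod c)\<^sup>2" for c
    by (metis complex_Re_le_cmod norm_power)
  from this[of z] this[of y] have "Re (z\<^sup>2) \<le> (cmod z)\<^sup>2" "Re (y\<^sup>2) \<le> (cmod y)\<^sup>2" .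
  ultimately show False
    using assms unfolding in_ball_def by linarith
qed

lemma sharp_tau_vec_ball_point:
  assumes "in_ball w z y"
  shows "sharp (tau_vec (ball_point w z y)) = sharp_mat w z y"
proof -
  define D where "D = 2 * w + z\<^sup>2 + y\<^sup>2"
  have D: "D \<noteq> 0" using in_ball_denominator[OF assms] by (simp add: D_def)
  have w: "w = (D - z\<^sup>2 - y\<^sup>2) / 2" by (simp add: D_def)
  define t where "t = tau_vec (ball_point w z y)"
  \<comment> \<open>\<open>u\<close> is \<open>U *v ball_point w z y\<close>; as \<open>U\<close> is
    symmetric, \<open>tau\<close> becomes \<open>\<i>\<close> times a rank one perturbation of
    \<open>U\<close>.\<close>
  define u :: "complex^4" where "u = vector [w, 1, z, y]"
  have bil: "bil (ball_point w z y) (U *v ball_point w z y) = D"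
    by (simp add: bil_def matrix_vector_mult_def ball_point_def U_def sum_4 D_def power2_eq_square)
  have t: "t $ i $ j = \<i> * (U $ i $ j - 2 / D * u $ i * u $ j)" for i j
  proof -
    have "t $ i $ j = \<i> * (\<Sum>k\<in>UNIV. U $ i $ k * ((if k = j then 1 else 0) - 2 / D * (\<Sum>l\<in>UNIV. ball_point w z y $ k * ball_point w z y $ l * U $ l $ j)))"
      by (simp add: t_def tau_vec_def smult_mat_def matrix_matrix_mult_def mat_def outer_def bil)
    moreover have "i = 1 \<or> i = 2 \<or> i = 3 \<or> i = 4" "j = 1 \<or> j = 2 \<or> j = 3 \<or> j = 4"
      using exhaust_4 by blast+
    ultimately show ?thesis
      by (auto simp: sum_4 U_def ball_point_def u_def algebra_simps)
  qed
  define B where "B = N21 ** t + N22"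
  \<comment> \<open>\<open>B\<close> differs from the identity only in its second row, which is that
    of \<open>t\<close>, so a right inverse can be written down once \<open>t $ 2 $ 2\<close> is
    nonzero.\<close>
  define B' :: "complex^4^4" where "B' = vector [vector [1, 0, 0, 0],
     vector [- t $ 2 $ 1 / t $ 2 $ 2, 1 / t $ 2 $ 2, - t $ 2 $ 3 / t $ 2 $ 2, - t $ 2 $ 4 / t $ 2 $ 2],
     vector [0, 0, 1, 0], vector [0, 0, 0, 1]]"
  have t22: "t $ 2 $ 2 \<noteq> 0"
    using D by (simp add: t u_def U_def)
  have "B ** B' = mat 1"
    using t22 by (simp add: B_def B'_def N21_def N22_def diag4_def matrix_matrix_mult_def mat_def vec_eq_iff forall_4 sum_4)
  then have inv: "invertible B"
    using invertible_right_inverse by blast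
  \<comment> \<open>Multiplying out by \<open>B\<close> verifies the closed form without expanding
    \<open>matrix_inv\<close>.\<close>
  have "N11 ** t + N12 = sharp_mat w z y ** B"
    using D by (simp add: B_def N11_def N12_def N21_def N22_def diag4_def matrix_matrix_mult_def vec_eq_iff forall_4 sum_4
      sharp_mat_def Let_def t u_def U_def) (simp add: w field_simps power2_eq_square)
  then have "sharp t = sharp_mat w z y ** (B ** matrix_inv B)"
    by (simp add: sharp_def B_def matrix_mul_assoc)
  also have "\<dots> = sharp_mat w z y"
    using someI_ex[OF inv[unfolded invertible_def]] by (simp add: matrix_inv_def)
  finally show ?thesis by (simp add: t_def)
qed

text \<open>The mixed terms contain \<open>x $ 1\<close> and \<open>x $ 2\<close> only through
  \<open>\<xi>\<close>. Each bracket, multiplied by \<open>pi\<close>, is the exponent of a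
  \<open>gterm\<close>.\<close>

lemma quadratic_form_sharp_mat:
  fixes x :: "real^4"
  defines "X \<equiv> (\<chi> i. of_real (x $ i)) :: complex^4" and "\<xi> \<equiv> Complex (x $ 1) (x $ 2)"
  shows "\<i> * bil (X v* sharp_mat w z y) X = w * of_real ((cmod \<xi>)\<^sup>2)
    + (- (of_real (x $ 3))\<^sup>2 + 2 * (\<xi> * z) * of_real (x $ 3) - (\<xi> * z)\<^sup>2 / 2)
    + (- (of_real (x $ 4))\<^sup>2 + 2 * (\<xi> * y) * of_real (x $ 4) - (\<xi> * y)\<^sup>2 / 2)"
proof -
  have xi: "\<xi> = of_real (x $ 1) + \<i> * of_real (x $ 2)"
    by (simp add: \<xi>_def complex_eq_iff)
  have norm: "(cmod \<xi>)\<^sup>2 = (x $ 1)\<^sup>2 + (x $ 2)\<^sup>2"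
    by (simp add: \<xi>_def cmod_power2)
  show ?thesis
    unfolding norm unfolding xi
    by (simp add: bil_def X_def vector_matrix_mult_def sum_4 sharp_mat_def Let_def)
      (simp add: power2_eq_square field_simps)
qed

text \<open>Taking floors inverts the shifts by \<open>p / 2\<close> and \<open>q / 2\<close>, since
  these lie in \<open>[0, 1)\<close>. Equal entries within each pair suffice for the four
  characteristics in question.\<close>

lemma theta_sharp_mat:
  assumes "p \<in> {0, 1}" "q \<in> {0, 1}"
  defines "A \<equiv> if p = 0 then gauss_ints else half_gauss_ints" and "B \<equiv> if q = 0 then \<int> else half_ints"
  shows "theta (vector [p, p, q, q]) (vector [b, b, d, d]) (sharp_mat w z y) =
    (\<Sum>\<^sub>\<infinity>(\<xi>, x, x')\<in>A \<times> (B \<times> B). exp (\<i> * of_real pi * of_real (of_int b * (Re \<xi> + Im \<xi>))) *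
      (exp (of_real pi * w * of_real ((cmod \<xi>)\<^sup>2)) *
      ((exp (\<i> * of_real pi * of_real (of_int d * x)) * gterm (\<xi> * z) x) *
       (exp (\<i> * of_real pi * of_real (of_int d * x')) * gterm (\<xi> * y) x'))))"
  unfolding theta_def
proof (rule infsum_reindex_bij_witness[of _ "\<lambda>(\<xi>, x, x'). vector [\<lfloor>Re \<xi>\<rfloor>, \<lfloor>Im \<xi>\<rfloor>, \<lfloor>x\<rfloor>, \<lfloor>x'\<rfloor>]"
     "\<lambda>k. (Complex (k $ 1 + p / 2) (k $ 2 + p / 2), k $ 3 + q / 2, k $ 4 + q / 2)"])
  have floor_p: "\<lfloor>real_of_int m + real_of_int p / 2\<rfloor> = m" and floor_q: "\<lfloor>real_of_int m + real_of_int q / 2\<rfloor> = m" for m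
    using assms(1,2) by (auto simp: floor_unique)
  fix k :: "int^4"
  show "(case (Complex (k $ 1 + p / 2) (k $ 2 + p / 2), k $ 3 + q / 2, k $ 4 + q / 2) of
     (\<xi>, x, x') \<Rightarrow> vector [\<lfloor>Re \<xi>\<rfloor>, \<lfloor>Im \<xi>\<rfloor>, \<lfloor>x\<rfloor>, \<lfloor>x'\<rfloor>]) = k"
    by (simp add: floor_p floor_q vec_eq_iff forall_4)
  show "(Complex (k $ 1 + p / 2) (k $ 2 + p / 2), k $ 3 + q / 2, k $ 4 + q / 2) \<in> A \<times> B \<times> B"
    using assms(1,2) by (auto simp: A_def B_def gauss_ints_def half_gauss_ints_def)
  define x :: "real^4" where "x = vector [k $ 1 + p / 2, k $ 2 + p / 2, k $ 3 + q / 2, k $ 4 + q / 2]"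
  define X :: "complex^4" where "X = (\<chi> i. of_real (x $ i))"
  define \<xi> where "\<xi> = Complex (x $ 1) (x $ 2)"
  have hs: "half_shift k (vector [p, p, q, q]) = X"
    by (simp add: half_shift_def X_def x_def vec_eq_iff forall_4)
  have b: "bil X (half_shift 0 (vector [b, b, d, d])) = of_real (of_int b * (x $ 1 + x $ 2) + of_int d * x $ 3 + of_int d * x $ 4) / 2"
    by (simp add: bil_def half_shift_def X_def sum_4 field_simps)
  have "2 * of_real pi * \<i> * (1 / 2 * bil (X v* sharp_mat w z y) X + bil X (half_shift 0 (vector [b, b, d, d])))
    = of_real pi * (\<i> * bil (X v* sharp_mat w z y) X) + \<i> * of_real pi * (2 * bil X (half_shift 0 (vector [b, b, d, d])))"
    by (simp add: algebra_simps)
  also have "exp \<dots> = exp (\<i> * of_real pi * of_real (of_int b * (Re \<xi> + Im \<xi>))) *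
      (exp (of_real pi * w * of_real ((cmod \<xi>)\<^sup>2)) *
      ((exp (\<i> * of_real pi * of_real (of_int d * x $ 3)) * gterm (\<xi> * z) (x $ 3)) *
       (exp (\<i> * of_real pi * of_real (of_int d * x $ 4)) * gterm (\<xi> * y) (x $ 4))))"
    unfolding gterm_def exp_add[symmetric] b unfolding X_def quadratic_form_sharp_mat \<xi>_def
    by (rule arg_cong[of _ _ exp]) (simp add: algebra_simps)
  finally show "(case (Complex (k $ 1 + p / 2) (k $ 2 + p / 2), k $ 3 + q / 2, k $ 4 + q / 2) of
     (\<xi>, x, x') \<Rightarrow> exp (\<i> * of_real pi * of_real (of_int b * (Re \<xi> + Im \<xi>))) *
      (exp (of_real pi * w * of_real ((cmod \<xi>)\<^sup>2)) *
      ((exp (\<i> * of_real pi * of_real (of_int d * x)) * gterm (\<xi> * z) x) *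
       (exp (\<i> * of_real pi * of_real (of_int d * x')) * gterm (\<xi> * y) x')))) =
    exp (2 * of_real pi * \<i> * (1 / 2 * bil (half_shift k (vector [p, p, q, q]) v* sharp_mat w z y) (half_shift k (vector [p, p, q, q]))
       + bil (half_shift k (vector [p, p, q, q])) (half_shift 0 (vector [b, b, d, d]))))"
    unfolding hs \<xi>_def x_def by simp
next
  fix t :: "complex \<times> real \<times> real"
  assume t: "t \<in> A \<times> B \<times> B"
  have floor: "real_of_int \<lfloor>x\<rfloor> + real_of_int q / 2 = x" if "x \<in> B" for x
    using that assms(2) by (auto simp: B_def half_ints_altdef elim!: Ints_cases split: if_splits)
  have floor': "Complex (real_of_int \<lfloor>Re x\<rfloor> + real_of_int p / 2) (real_of_int \<lfloor>Im x\<rfloor> + real_of_int p / 2) = x" if "x \<in> A" for x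
    using that assms(1) by (auto simp: A_def elim!: gauss_intsE half_gauss_intsE split: if_splits)
  from t show "(case t of (\<xi>, x, x') \<Rightarrow> vector [\<lfloor>Re \<xi>\<rfloor>, \<lfloor>Im \<xi>\<rfloor>, \<lfloor>x\<rfloor>, \<lfloor>x'\<rfloor>]) \<in> UNIV" 
    and "(\<lambda>k :: int^4. (Complex (k $ 1 + p / 2) (k $ 2 + p / 2), k $ 3 + q / 2, k $ 4 + q / 2))
      (case t of (\<xi>, x, x') \<Rightarrow> vector [\<lfloor>Re \<xi>\<rfloor>, \<lfloor>Im \<xi>\<rfloor>, \<lfloor>x\<rfloor>, \<lfloor>x'\<rfloor>]) = t"
    by (auto simp: floor floor')
qed

lemma theta_values:
  assumes "in_ball w z y"
  shows "theta c0000 c0000 (sharp_mat w z y) = ThetaP w z y"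
    "theta c1100 c0000 (sharp_mat w z y) = ThetaQ w z y"
    "theta c0000 c1100 (sharp_mat w z y) = ThetaR w z y"
    "theta c1111 c1111 (sharp_mat w z y) = ThetaS w z y"
proof -
  note series = infsum_planar_series[OF assms]
  show "theta c0000 c0000 (sharp_mat w z y) = ThetaP w z y"
    using theta_sharp_mat[of 0 0 0 0 w z y] series[of gauss_ints \<int> "\<lambda>_. 1" "\<lambda>_. 1" theta3]
    by (simp add: ThetaP_def theta3_def)
  show "theta c1100 c0000 (sharp_mat w z y) = ThetaQ w z y"
    using theta_sharp_mat[of 1 0 0 0 w z y] series[of half_gauss_ints \<int> "\<lambda>_. 1" "\<lambda>_. 1" theta3]
    by (simp add: ThetaQ_def theta3_def)
  show "theta c0000 c1100 (sharp_mat w z y) = ThetaR w z y"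
    using theta_sharp_mat[of 0 0 1 0 w z y] series[of gauss_ints \<int> gchar "\<lambda>_. 1" theta3]
    by (simp add: ThetaR_def theta3_def gchar_def)
  show "theta c1111 c1111 (sharp_mat w z y) = ThetaS w z y"
    using theta_sharp_mat[of 1 1 1 1 w z y]
      series[of half_gauss_ints half_ints gchar "\<lambda>x. exp (\<i> * of_real pi * of_real x)" theta1]
    by (simp add: ThetaS_def theta1_def gchar_def)
qed

text \<open>A vanishing first coordinate would make the hermitian form nonnegative, so division by
  it is possible. All scalars, including that of \<open>mean_mat\<close>, disappear because
  \<open>tau_vec\<close> is homogeneous of degree 0.\<close>

lemma normalise_calB:
  assumes "v \<in> calB"
  obtains w z y where "in_ball w z y" "tau_vec v = tau_vec (ball_point w z y)"
    "tau_vec (mean_mat *v v) = tau_vec (ball_point (2 * w) (z - \<i> * y) (y - \<i> * z))"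
proof -
  have v1: "v $ 1 \<noteq> 0"
  proof
    assume "v $ 1 = 0"
    then have "Re (herm_form v) = (cmod (v $ 3))\<^sup>2 + (cmod (v $ 4))\<^sup>2"
      unfolding cmod_power2 by (simp add: herm_form_expand power2_eq_square)
    moreover have "Re (herm_form v) < 0" using assms by (simp add: calB_def)
    ultimately show False by (smt (verit) zero_le_power2)
  qed
  define w z y where "w = v $ 2 / v $ 1" and "z = v $ 3 / v $ 1" and "y = v $ 4 / v $ 1"
  have v: "v = v $ 1 *s ball_point w z y"
    using v1 by (simp add: ball_point_def w_def z_def y_def vec_eq_iff forall_4)
  have "herm_form (ball_point w z y) = of_real (2 * Re w + (cmod z)\<^sup>2 + (cmod y)\<^sup>2)"
    unfolding cmod_power2 by (simp add: herm_form_expand ball_point_def complex_eq_iff power2_eq_square)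
  moreover have "Re (herm_form v) < 0"
    using assms by (simp add: calB_def)
  ultimately have "(cmod (v $ 1))\<^sup>2 * (2 * Re w + (cmod z)\<^sup>2 + (cmod y)\<^sup>2) < 0"
    by (subst (asm) v) (simp add: herm_form_scale)
  then have "in_ball w z y"
    using v1 by (simp add: in_ball_def mult_less_0_iff)
  moreover have "tau_vec v = tau_vec (ball_point w z y)"
    by (subst v) (rule tau_vec_scale[OF v1])
  moreover have "tau_vec (mean_mat *v v) = tau_vec (ball_point (2 * w) (z - \<i> * y) (y - \<i> * z))"
  proof -
    have "mean_mat *v v = (1 / (1 - \<i>) * v $ 1) *s ball_point (2 * w) (z - \<i> * y) (y - \<i> * z)"
      using v1 by (simp add: mean_mat_vec ball_point_def w_def z_def y_def vec_eq_iff forall_4 field_simps)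
    moreover have "1 / (1 - \<i>) * v $ 1 \<noteq> 0"
      using v1 by (simp add: complex_eq_iff[of "1 - \<i>"] complex_eq_iff[of 1 \<i>])
    ultimately show ?thesis by (metis tau_vec_scale)
  qed
  ultimately show ?thesis using that by blast
qed

lemma in_ball_mean: "in_ball w z y \<Longrightarrow> in_ball (2 * w) (z - \<i> * y) (y - \<i> * z)"
proof -
  have "(cmod (z - \<i> * y))\<^sup>2 + (cmod (y - \<i> * z))\<^sup>2 = 2 * (cmod z)\<^sup>2 + 2 * (cmod y)\<^sup>2"
    unfolding cmod_power2 by (simp add: power2_eq_square algebra_simps)
  then show "in_ball w z y \<Longrightarrow> in_ball (2 * w) (z - \<i> * y) (y - \<i> * z)"
    by (simp add: in_ball_def)
qed

theorem theorem5p4: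
  fixes v :: ball3
  shows "fa (mean_gen v) = (fa v + fb1 v + fb2 v + fb3 v) / 4 \<and>
         (fb1 (mean_gen v))\<^sup>2 = (fa v + fb3 v) * (fb1 v + fb2 v) / 4 \<and>
         (fb2 (mean_gen v))\<^sup>2 = (fa v + fb2 v) * (fb1 v + fb3 v) / 4 \<and>
         (fb3 (mean_gen v))\<^sup>2 = (fa v + fb1 v) * (fb2 v + fb3 v) / 4"
proof -
  define r where "r = rep_ball3 v"
  have r: "proj_eq r r" and v: "v = abs_ball3 r"
    unfolding r_def using Quotient_rep_reflp[OF Quotient_ball3] Quotient_abs_rep[OF Quotient_ball3] by simp_all
  then have "r \<in> calB" by (simp add: proj_eq_def)
  then obtain w z y where ball: "in_ball w z y" and tau: "tau_vec r = tau_vec (ball_point w z y)"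
    "tau_vec (mean_mat *v r) = tau_vec (ball_point (2 * w) (z - \<i> * y) (y - \<i> * z))"
    by (rule normalise_calB)
  \<comment> \<open>The image vector must lie in the domain of the partial quotient before
    \<open>tau\<close> of its class can be evaluated; the scalar is 1.\<close>
  have "proj_eq (mean_mat *v r) (mean_mat *v r)"
    using \<open>r \<in> calB\<close> herm_form_real herm_form_mean_mat[of r] unfolding proj_eq_def calB_def
    by (auto intro!: exI[of _ 1])
  then have "sharp (tau v) = sharp_mat w z y"
    "sharp (tau (mean_gen v)) = sharp_mat (2 * w) (z - \<i> * y) (y - \<i> * z)"
    using r by (simp_all add: v tau.abs_eq mean_gen.abs_eq tau sharp_tau_vec_ball_point ball in_ball_mean)
  note theta_eqs = this theta_values[OF ball] theta_values[OF in_ball_mean[OF ball]]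
  \<comment> \<open>Write P, Q, R, S for the theta values at \<open>v\<close> and P', Q', R', S' for
    those at its image. Then \<open>fb1\<close> is squared as (P'^2 + Q'^2)^2 - 4 (P' Q')^2, the
    squares of \<open>fb1\<close> and \<open>fb2\<close> factor as differences of squares, and
    \<open>fb3\<close> of the image is P R.\<close>
  show ?thesis
    unfolding fa_def fb1_def fb2_def fb3_def theta_eqs
    using mean_even[OF ball] mean_product[OF ball] mean_character[OF ball] mean_character_square[OF ball]
    by algebra
qed

end
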